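(* Let a sequence of sparse vectors $\{\mathbf{x}^{(M)}\in\mathbb{C}^M\}_M$ with $\|\mathbf{x}^{(M)}\|_0=L=o(M)$ be given. Then asymptotic reliable recovery is possible for $\{\mathbf{x}^{(M)}\}$ with respect to Error Metric 1 if $L\,\mu^4(\mathbf{x}^{(M)})\to\infty$ as $L\to\infty$ and $N\succ C'_1\,L\log(M-L)$, for some constant $C'_1>0$ that depends only on $\mu(\mathbf{x}^{(M)})$ and $\nu$.
   Context: Model: $\mathbf{x}=\mathbf{x}^{(M)}\in\mathbb{C}^M$ is an unknown vector with support $\mathcal{I}=\{i: x_i\ne0\}$, $\|\mathbf{x}\|_0=|\mathcal{I}|=L$, and $\mu(\mathbf{x})=\min_{i\in\mathcal{I}}|x_i|$. One observes $\mathbf{y}=\mathbf{A}\mathbf{x}+\mathbf{n}\in\mathbb{C}^N$, where $N$ is a function of $M$, $\mathbf{A}$ is an $N\times M$ Gaussian measurement matrix (i.i.d. circularly symmetric complex Gaussian entries $a_{i,j}\sim\mathcal{N}_C(0,1)$), and $\mathbf{n}\sim\mathcal{N}_C(0,\nu^2I_N)$ is circularly symmetric complex Gaussian noise independent of $\mathbf{A}$. Decoder: a sparse recovery algorithm, knowing $\mathbf{A}$ and observing $\mathbf{y}$, outputs an estimate $\hat{\mathbf{x}}$ with $\|\hat{\mathbf{x}}\|_0=L$; a decoder $\mathcal{D}$ outputs the corresponding set of indices $\mathcal{D}(\mathbf{y})=\{i:\hat x_i\ne0\}$. Error Metric 1 ($0$-$1$ loss): recovery is successful iff $\hat x_i\ne0$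 for all $i\in\mathcal{I}$ and $\hat x_j=0$ for all $j\notin\mathcal{I}$, i.e. iff $\mathcal{D}(\mathbf{y})=\mathcal{I}$. For fixed $\mathbf{A}$, $p_{\rm err}(\mathbf{A}|\mathbf{x}^{(M)})=\mathbb{P}(\mathcal{D}(\mathbf{y})\ne\mathcal{I})$, and $p_{\rm err}(\mathcal{D}|\mathbf{x}^{(M)})=\mathbb{E}_{\mathbf{A}}\big(p_{\rm err}(\mathbf{A}|\mathbf{x}^{(M)})\big)$ is its average over Gaussian measurement matrices. A decoder achieves asymptotic reliable recovery if $p_{\rm err}(\mathcal{D}|\mathbf{x}^{(M)})\to0$ as $M\to\infty$; recovery is possible if some decoder achieves this. Notation: $f\succ g$ means that either $f=g=0$, or $f,g$ are non-decreasing non-negative functions and there is $x_0$ such that $f(x)/g(x)>1$ for all $x>x_0$ (here as functions of $M$). *)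

theory Defs
  imports "HOL-Probability.Probability" "HOL-Library.Landau_Symbols"
begin

text \<open>A vector in $C^M$ is a function on \<open>nat\<close> of which only the values on \<open>{..<M}\<close> matter;
  a sequence of vectors $x^{(M)}$ has type \<open>nat \<Rightarrow> nat \<Rightarrow> complex\<close>.\<close>

definition supp :: "nat \<Rightarrow> (nat \<Rightarrow> complex) \<Rightarrow> nat set" where
  "supp M x = {i \<in> {..<M}. x i \<noteq> 0}"

definition l0 :: "nat \<Rightarrow> (nat \<Rightarrow> complex) \<Rightarrow> nat" where
  "l0 M x = card (supp M x)"

text \<open>Meaningful only for vectors with nonempty support.\<close>

definition min_mag :: "nat \<Rightarrow> (nat \<Rightarrow> complex) \<Rightarrow> real" where
  "min_mag M x = Min ((\<lambda>i. cmod (x i)) ` supp M x)"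

text \<open>The circularly symmetric complex Gaussian law with variance \<open>v > 0\<close>: real and imaginary
  parts are independent, centred and real normal with variance \<open>v / 2\<close> each.
  The second parameter of \<^const>\<open>normal_density\<close> is the standard deviation.\<close>

definition complex_gaussian :: "real \<Rightarrow> complex measure" where
  "complex_gaussian v =
     (let R = density lborel (\<lambda>t. ennreal (normal_density 0 (sqrt (v / 2)) t))
      in distr (R \<Otimes>\<^sub>M R) borel (\<lambda>(a, b). Complex a b))"

definition gaussian_matrix :: "nat \<Rightarrow> nat \<Rightarrow> (nat \<times> nat \<Rightarrow> complex) measure" where
  "gaussian_matrix N M = (\<Pi>\<^sub>M ij\<in>{..<N} \<times> {..<M}. complex_gaussian 1)"

definition gaussian_noise :: "real \<Rightarrow> nat \<Rightarrow> (nat \<Rightarrow> complex) measure" where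
  "gaussian_noise \<nu> N = (\<Pi>\<^sub>M i\<in>{..<N}. complex_gaussian (\<nu>\<^sup>2))"

definition observe ::
  "nat \<Rightarrow> nat \<Rightarrow> (nat \<times> nat \<Rightarrow> complex) \<Rightarrow> (nat \<Rightarrow> complex) \<Rightarrow> (nat \<Rightarrow> complex) \<Rightarrow> nat \<Rightarrow> complex"
  where
  "observe N M A x n = (\<lambda>i\<in>{..<N}. (\<Sum>j<M. A (i, j) * x j) + n i)"

text \<open>A decoder sees the matrix and the observation and returns a set of exactly \<open>L M\<close> indices.
  Measurability makes the error events below measurable; without it \<^const>\<open>measure\<close> could
  return \<open>0\<close> by convention.\<close>

definition is_decoder ::
  "(nat \<Rightarrow> nat) \<Rightarrow> (nat \<Rightarrow> nat) \<Rightarrow>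
   (nat \<Rightarrow> (nat \<times> nat \<Rightarrow> complex) \<Rightarrow> (nat \<Rightarrow> complex) \<Rightarrow> nat set) \<Rightarrow> bool" where
  "is_decoder N L D \<longleftrightarrow>
     (\<forall>M. (\<lambda>(A, y). D M A y) \<in>
        (\<Pi>\<^sub>M ij\<in>{..<N M} \<times> {..<M}. borel) \<Otimes>\<^sub>M (\<Pi>\<^sub>M i\<in>{..<N M}. borel)
          \<rightarrow>\<^sub>M count_space {J. J \<subseteq> {..<M} \<and> card J = L M})"

definition p_err_given ::
  "real \<Rightarrow> nat \<Rightarrow> nat \<Rightarrow> ((nat \<times> nat \<Rightarrow> complex) \<Rightarrow> (nat \<Rightarrow> complex) \<Rightarrow> nat set) \<Rightarrow>
   (nat \<Rightarrow> complex) \<Rightarrow> (nat \<times> nat \<Rightarrow> complex) \<Rightarrow> real" where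
  "p_err_given \<nu> N M d x A =
     measure (gaussian_noise \<nu> N)
       {n \<in> space (gaussian_noise \<nu> N). d A (observe N M A x n) \<noteq> supp M x}"

definition p_err ::
  "real \<Rightarrow> nat \<Rightarrow> nat \<Rightarrow> ((nat \<times> nat \<Rightarrow> complex) \<Rightarrow> (nat \<Rightarrow> complex) \<Rightarrow> nat set) \<Rightarrow>
   (nat \<Rightarrow> complex) \<Rightarrow> real" where
  "p_err \<nu> N M d x = (\<integral>A. p_err_given \<nu> N M d x A \<partial>gaussian_matrix N M)"

definition achieves_reliable_recovery ::
  "real \<Rightarrow> (nat \<Rightarrow> nat) \<Rightarrow>
   (nat \<Rightarrow> (nat \<times> nat \<Rightarrow> complex) \<Rightarrow> (nat \<Rightarrow> complex) \<Rightarrow> nat set) \<Rightarrow>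
   (nat \<Rightarrow> nat \<Rightarrow> complex) \<Rightarrow> bool" where
  "achieves_reliable_recovery \<nu> N D x \<longleftrightarrow> (\<lambda>M. p_err \<nu> (N M) M (D M) (x M)) \<longlonglongrightarrow> 0"

text \<open>The decoder must not know the vector: if it could be chosen depending on \<open>x\<close>, the decoder
  that constantly returns the support of \<open>x\<close> would always succeed. So one decoder has to succeed
  for every sequence \<open>x'\<close> that has the same sparsity and the same minimal magnitude as \<open>x\<close>.
  It may depend on these two parameters, on \<open>\<nu>\<close> and on \<open>N\<close>, but not on the position of the support
  or on the values of the entries.\<close>

definition reliable_recovery_possible ::
  "real \<Rightarrow> (nat \<Rightarrow> nat) \<Rightarrow> (nat \<Rightarrow> nat \<Rightarrow> complex) \<Rightarrow> bool" where
  "reliable_recovery_possible \<nu> N x \<longleftrightarrow>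
     (\<exists>D. is_decoder N (\<lambda>M. l0 M (x M)) D \<and>
        (\<forall>x'. (\<forall>M. l0 M (x' M) = l0 M (x M) \<and> min_mag M (x' M) = min_mag M (x M)) \<longrightarrow>
           achieves_reliable_recovery \<nu> N D x'))"

definition asymp_succ :: "(nat \<Rightarrow> real) \<Rightarrow> (nat \<Rightarrow> real) \<Rightarrow> bool" (infix "\<succ>\<^sub>a" 50) where
  "f \<succ>\<^sub>a g \<longleftrightarrow>
     (\<forall>M. f M = 0 \<and> g M = 0) \<or>
     (mono f \<and> mono g \<and> (\<forall>M. 0 \<le> f M) \<and> (\<forall>M. 0 \<le> g M) \<and> (\<exists>M\<^sub>0. \<forall>M>M\<^sub>0. f M / g M > 1))"

end

theory Submission
  imports Defs "HOL-Library.Nat_Bijection" "HOL-Real_Asymp.Real_Asymp"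
begin

text \<open>Decode by least squares: among all $J$ with $|J| = L$ choose one that minimises the squared
  distance of $y$ to the span of the columns $A_J$. Let $I$ be the true support and
  $k = |I \setminus J|$. If $J$ beats $I$, then the distance of $A_{I \setminus J}\,x + n$ to the
  span of $A_J$ is at most that of $n$ to the span of $A_{I \cap J}$. Given $A_J$, the Chernoff
  bound with parameter $1/(2\nu^2)$ for the difference of the two squared distances is a Gaussian
  integral, and in an orthonormal basis adapted to the two spans it shows that this has probability
  at most $2^k (1 + k\mu^2/(4\nu^2))^{-(N-L)}$. Since $L\mu^2 \to \infty$ and
  $\ln (1 + k\theta) \ge (k/L) \ln (1 + L\theta)$, this is at most $r^{2k}$ with
  $r = 2 (M-L)^{-3}$, and $2k$ is the size of the symmetric difference of $I$ and $J$; so the union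
  bound gives at most $(1 + r)^M - 1 \to 0$. Comparing the two residuals directly, instead of each
  with a threshold, makes $C'_1 = 2$ sufficient for all $\mu$ and $\nu$.\<close>

section \<open>Gaussian integrals\<close>

text \<open>The obstacle: the adapted basis depends on the matrix, while the Gaussian laws are given
  coordinate by coordinate. In place of unitary invariance, an auxiliary Gaussian vector turns the
  exponent into a sum over the original coordinates, Fubini integrates these out, and a second
  Gaussian integral removes the auxiliary vector. Only one-dimensional integrals are ever computed.
  The columns of \<open>I - J\<close> are averaged first, the noise afterwards. With Chernoff
  parameter \<open>s\<close> and \<open>T\<close> the sum of \<open>|x j|^2\<close> over
  \<open>I - J\<close>, each dimension orthogonal to the span of \<open>A_J\<close> contributes
  \<open>1 / (1 + T * s * (1 - \<nu>^2 * s))\<close>. The value \<open>s = 1 / (2 * \<nu>^2)\<close>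
  maximises \<open>s * (1 - \<nu>^2 * s)\<close>, which is the origin of \<open>4 * \<nu>^2\<close>.
  The at most \<open>k\<close> dimensions by which the span of \<open>A_J\<close> exceeds that of
  the common columns carry the noise term alone and cost a factor 2 each.\<close>

lemma nn_integral_normal_exp_quadratic:
  fixes s q v :: real
  assumes v: "0 < v" and sv: "0 < 1 + s * v"
  shows "(\<integral>\<^sup>+t. ennreal (exp (- s * t\<^sup>2 + 2 * q * t))
            \<partial>density lborel (\<lambda>t. ennreal (normal_density 0 (sqrt (v / 2)) t)))
         = ennreal (exp (v * q\<^sup>2 / (1 + s * v)) / sqrt (1 + s * v))"
proof -
  \<comment> \<open>Completing the square makes the integrand a multiple of the normal density with
    mean \<open>w * q\<close> and variance \<open>w / 2\<close>. Negative \<open>s\<close> is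
    covered as long as \<open>1 + s * v > 0\<close>; moment generating functions of squared moduli
    rely on that.\<close>
  define w where "w = v / (1 + s * v)"
  have w: "0 < w" using assms by (simp add: w_def)
  define c where "c = exp (v * q\<^sup>2 / (1 + s * v)) / sqrt (1 + s * v)"
  have c: "0 \<le> c" using sv by (simp add: c_def)
  have wv: "v = w * (1 + s * v)" using sv by (simp add: w_def)
  have iw: "1 / w = 1 / v + s" using assms by (simp add: w_def field_simps)
  have wexp: "v * q\<^sup>2 / (1 + s * v) = w * q\<^sup>2" by (simp add: w_def)
  have eq: "normal_density 0 (sqrt (v / 2)) t * exp (- s * t\<^sup>2 + 2 * q * t)
            = c * normal_density (w * q) (sqrt (w / 2)) t" for t
  proof -
    have "- (t\<^sup>2 / v) + (- s * t\<^sup>2 + 2 * q * t) = - (t\<^sup>2 * (1 / v + s)) + 2 * q * t"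
      by (simp add: algebra_simps)
    also have "\<dots> = w * q\<^sup>2 + - ((t - w * q)\<^sup>2 / w)"
      unfolding iw[symmetric] using w by (simp add: power2_eq_square field_simps)
    finally have ex: "exp (- (t\<^sup>2 / v)) * exp (- s * t\<^sup>2 + 2 * q * t)
                      = exp (w * q\<^sup>2) * exp (- ((t - w * q)\<^sup>2 / w))"
      by (simp flip: exp_add)
    have sq: "sqrt (pi * v) = sqrt (pi * w) * sqrt (1 + s * v)"
      by (metis mult.assoc real_sqrt_mult wv)
    have "normal_density 0 (sqrt (v / 2)) t * exp (- s * t\<^sup>2 + 2 * q * t)
            = 1 / sqrt (pi * v) * (exp (- (t\<^sup>2 / v)) * exp (- s * t\<^sup>2 + 2 * q * t))"
      using v by (simp add: normal_density_def)
    also have "\<dots> = exp (w * q\<^sup>2) / sqrt (1 + s * v) * (1 / sqrt (pi * w) * exp (- ((t - w * q)\<^sup>2 / w)))"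
      unfolding ex sq by simp
    also have "\<dots> = c * normal_density (w * q) (sqrt (w / 2)) t"
      using w unfolding normal_density_def c_def by (simp add: wexp)
    finally show ?thesis .
  qed
  have "(\<integral>\<^sup>+t. ennreal (exp (- s * t\<^sup>2 + 2 * q * t))
            \<partial>density lborel (\<lambda>t. ennreal (normal_density 0 (sqrt (v / 2)) t)))
        = (\<integral>\<^sup>+t. ennreal (normal_density 0 (sqrt (v / 2)) t) * ennreal (exp (- s * t\<^sup>2 + 2 * q * t)) \<partial>lborel)"
    by (subst nn_integral_density) auto
  also have "\<dots> = (\<integral>\<^sup>+t. ennreal c * ennreal (normal_density (w * q) (sqrt (w / 2)) t) \<partial>lborel)"
    by (intro nn_integral_cong) (simp only: eq c normal_density_nonneg exp_ge_zero flip: ennreal_mult)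
  also have "\<dots> = ennreal c * (\<integral>\<^sup>+t. ennreal (normal_density (w * q) (sqrt (w / 2)) t) \<partial>lborel)"
    by (rule nn_integral_cmult) auto
  also have "(\<integral>\<^sup>+t. ennreal (normal_density (w * q) (sqrt (w / 2)) t) \<partial>lborel) = 1"
    using w by (subst nn_integral_eq_integral)
      (auto intro!: integrable_normal_density simp: integral_normal_density)
  finally show ?thesis by (simp add: c_def)
qed

lemma measurable_Complex [measurable]:
  "case_prod Complex \<in> borel \<Otimes>\<^sub>M borel \<rightarrow>\<^sub>M borel"
proof -
  have "case_prod Complex = (\<lambda>(a, b). complex_of_real a + \<i> * complex_of_real b)"
    by (auto simp: complex_eq_iff)
  then show ?thesis by simp
qed

lemma sets_complex_gaussian [simp, measurable_cong]: "sets (complex_gaussian v) = sets borel"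
  by (simp add: complex_gaussian_def Let_def)

lemma space_complex_gaussian [simp]: "space (complex_gaussian v) = UNIV"
  by (simp add: complex_gaussian_def Let_def)

lemma prob_space_complex_gaussian:
  assumes "0 < v"
  shows "prob_space (complex_gaussian v)"
proof -
  let ?R = "density lborel (\<lambda>t. ennreal (normal_density 0 (sqrt (v / 2)) t))"
  interpret R: prob_space ?R
    using assms by (intro prob_space_normal_density) auto
  interpret RR: pair_prob_space ?R ?R ..
  show ?thesis
    unfolding complex_gaussian_def Let_def by (rule RR.prob_space_distr) simp
qed

lemma nn_integral_complex_gaussian_exp_quadratic:
  fixes s v :: real and q :: complex
  assumes v: "0 < v" and sv: "0 < 1 + s * v"
  shows "(\<integral>\<^sup>+z. ennreal (exp (- s * (cmod z)\<^sup>2 + 2 * Re (cnj q * z))) \<partial>complex_gaussian v)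
         = ennreal (exp (v * (cmod q)\<^sup>2 / (1 + s * v)) / (1 + s * v))"
proof -
  let ?R = "density lborel (\<lambda>t. ennreal (normal_density 0 (sqrt (v / 2)) t))"
  let ?F = "\<lambda>q t. ennreal (exp (- s * t\<^sup>2 + 2 * q * t))"
  interpret R: prob_space ?R
    using assms by (intro prob_space_normal_density) auto
  interpret RR: pair_prob_space ?R ?R ..
  have "(\<integral>\<^sup>+z. ennreal (exp (- s * (cmod z)\<^sup>2 + 2 * Re (cnj q * z))) \<partial>complex_gaussian v)
        = (\<integral>\<^sup>+p. ennreal (exp (- s * (cmod (case_prod Complex p))\<^sup>2 + 2 * Re (cnj q * case_prod Complex p))) \<partial>(?R \<Otimes>\<^sub>M ?R))"
    unfolding complex_gaussian_def Let_def by (subst nn_integral_distr) auto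
  also have "\<dots> = (\<integral>\<^sup>+(a, b). ?F (Re q) a * ?F (Im q) b \<partial>(?R \<Otimes>\<^sub>M ?R))"
    by (intro nn_integral_cong)
      (auto simp: cmod_power2 algebra_simps simp flip: ennreal_mult exp_add split: prod.splits)
  also have "\<dots> = (\<integral>\<^sup>+a. \<integral>\<^sup>+b. ?F (Re q) a * ?F (Im q) b \<partial>?R \<partial>?R)"
    by (subst R.nn_integral_fst[symmetric]) auto
  also have "\<dots> = (\<integral>\<^sup>+a. ?F (Re q) a \<partial>?R) * (\<integral>\<^sup>+b. ?F (Im q) b \<partial>?R)"
    by (simp add: nn_integral_cmult nn_integral_multc)
  also have "\<dots> = ennreal (exp (v * (Re q)\<^sup>2 / (1 + s * v)) / sqrt (1 + s * v)
                         * (exp (v * (Im q)\<^sup>2 / (1 + s * v)) / sqrt (1 + s * v)))"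
    unfolding nn_integral_normal_exp_quadratic[OF assms] using sv by (simp flip: ennreal_mult)
  also have "exp (v * (Re q)\<^sup>2 / (1 + s * v)) / sqrt (1 + s * v)
                         * (exp (v * (Im q)\<^sup>2 / (1 + s * v)) / sqrt (1 + s * v))
        = exp (v * (cmod q)\<^sup>2 / (1 + s * v)) / (1 + s * v)"
    using sv by (simp add: cmod_power2 distrib_left add_divide_distrib exp_add)
  finally show ?thesis .
qed

text \<open>Averaging over one coordinate keeps the shape of the integrand and only lowers the
  weight from \<open>t\<close> to \<open>t / (1 + t * |c|^2)\<close>, so it can be repeated
  coordinate after coordinate.\<close>

lemma nn_integral_complex_gaussian_exp_shift:
  fixes t :: real and w c :: complex
  assumes t: "0 \<le> t"
  shows "(\<integral>\<^sup>+z. ennreal (exp (- t * (cmod (w + c * z))\<^sup>2)) \<partial>complex_gaussian 1)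
         = ennreal (exp (- (t / (1 + t * (cmod c)\<^sup>2)) * (cmod w)\<^sup>2) / (1 + t * (cmod c)\<^sup>2))"
proof -
  define s where "s = t * (cmod c)\<^sup>2"
  have s: "0 \<le> s" using t by (simp add: s_def)
  define q where "q = - (complex_of_real t * cnj c * w)"
  have *: "- t * (cmod (w + c * z))\<^sup>2 = - t * (cmod w)\<^sup>2 + (- s * (cmod z)\<^sup>2 + 2 * Re (cnj q * z))" for z
    unfolding s_def q_def cmod_power2 by (simp add: power2_eq_square algebra_simps)
  have q2: "(cmod q)\<^sup>2 = t * s * (cmod w)\<^sup>2"
    unfolding q_def s_def by (simp add: norm_mult power2_eq_square)
  have "(\<integral>\<^sup>+z. ennreal (exp (- t * (cmod (w + c * z))\<^sup>2)) \<partial>complex_gaussian 1)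
      = (\<integral>\<^sup>+z. ennreal (exp (- t * (cmod w)\<^sup>2)) * ennreal (exp (- s * (cmod z)\<^sup>2 + 2 * Re (cnj q * z))) \<partial>complex_gaussian 1)"
    by (intro nn_integral_cong) (simp only: * exp_add ennreal_mult' exp_ge_zero)
  also have "\<dots> = ennreal (exp (- t * (cmod w)\<^sup>2)) * ennreal (exp ((cmod q)\<^sup>2 / (1 + s)) / (1 + s))"
    using s nn_integral_complex_gaussian_exp_quadratic[of 1 s q] by (subst nn_integral_cmult) auto
  also have "\<dots> = ennreal (exp (- t * (cmod w)\<^sup>2 + (cmod q)\<^sup>2 / (1 + s)) / (1 + s))"
    using s unfolding exp_add by (simp flip: ennreal_mult)
  also have "- t * (cmod w)\<^sup>2 + (cmod q)\<^sup>2 / (1 + s) = - (t / (1 + s)) * (cmod w)\<^sup>2"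
    unfolding q2 using s by (simp add: field_simps)
  finally show ?thesis unfolding s_def .
qed

section \<open>Orthonormal systems\<close>

definition cinner :: "nat \<Rightarrow> (nat \<Rightarrow> complex) \<Rightarrow> (nat \<Rightarrow> complex) \<Rightarrow> complex" where
  "cinner N u v = (\<Sum>i<N. cnj (u i) * v i)"

definition sqnorm :: "nat \<Rightarrow> (nat \<Rightarrow> complex) \<Rightarrow> real" where
  "sqnorm N v = (\<Sum>i<N. (cmod (v i))\<^sup>2)"

text \<open>Nested subspaces are encoded as initial segments of one sequence \<open>u\<close>, so a
  chain of spans becomes a chain of numbers \<open>a \<le> b \<le> N\<close>.\<close>

definition orthonormal :: "nat \<Rightarrow> nat \<Rightarrow> (nat \<Rightarrow> nat \<Rightarrow> complex) \<Rightarrow> bool" where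
  "orthonormal N r u \<longleftrightarrow> (\<forall>j<r. \<forall>k<r. cinner N (u j) (u k) = of_bool (j = k))"

text \<open>For orthonormal \<open>u\<close> this is membership in the span of the first
  \<open>r\<close> vectors: the right-hand side is the orthogonal projection of
  \<open>v\<close>.\<close>

definition spanned :: "nat \<Rightarrow> nat \<Rightarrow> (nat \<Rightarrow> nat \<Rightarrow> complex) \<Rightarrow> (nat \<Rightarrow> complex) \<Rightarrow> bool" where
  "spanned N r u v \<longleftrightarrow> (\<forall>i<N. v i = (\<Sum>j<r. cinner N (u j) v * u j i))"

lemma cinner_cong: "(\<And>i. i < N \<Longrightarrow> u i = u' i) \<Longrightarrow> (\<And>i. i < N \<Longrightarrow> v i = v' i) \<Longrightarrow> cinner N u v = cinner N u' v'"
  by (simp add: cinner_def)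

lemma cinner_diff: "cinner N u (\<lambda>i. v i - w i) = cinner N u v - cinner N u w"
  by (simp add: cinner_def right_diff_distrib sum_subtractf)

lemma cinner_scale: "cinner N u (\<lambda>i. c * v i) = c * cinner N u v"
  by (simp add: cinner_def sum_distrib_left mult.left_commute)

lemma cinner_sum: "cinner N u (\<lambda>i. \<Sum>k\<in>K. c k * f k i) = (\<Sum>k\<in>K. c k * cinner N u (f k))"
  unfolding cinner_def sum_distrib_left by (subst sum.swap) (simp add: mult.left_commute)

lemma cnj_cinner: "cnj (cinner N u v) = cinner N v u"
  by (simp add: cinner_def mult.commute)

lemma cinner_self: "cinner N v v = of_real (sqnorm N v)"
  unfolding cinner_def sqnorm_def
  by (simp add: mult.commute[of "cnj _"] complex_norm_square[symmetric] del: of_real_power)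

lemma sqnorm_nonneg [simp]: "0 \<le> sqnorm N v"
  by (simp add: sqnorm_def sum_nonneg)

lemma sqnorm_zero_imp: "sqnorm N v = 0 \<Longrightarrow> i < N \<Longrightarrow> v i = 0"
  by (simp add: sqnorm_def sum_nonneg_eq_0_iff)

lemma orthonormal_mono: "orthonormal N r u \<Longrightarrow> r' \<le> r \<Longrightarrow> orthonormal N r' u"
  by (auto simp: orthonormal_def)

lemma cinner_orthonormal_sum:
  assumes "orthonormal N r u" "j < r"
  shows "cinner N (u j) (\<lambda>i. \<Sum>k<r. c k * u k i) = c j"
proof -
  have "(\<Sum>k<r. c k * cinner N (u j) (u k)) = (\<Sum>k<r. if k = j then c k else 0)"
    using assms by (intro sum.cong) (auto simp: orthonormal_def)
  then show ?thesis using assms(2) by (simp add: cinner_sum)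
qed

lemma cinner_orthonormal_sum_0:
  assumes "orthonormal N r u" "r' \<le> j" "j < r"
  shows "cinner N (u j) (\<lambda>i. \<Sum>k<r'. c k * u k i) = 0"
  using assms by (simp add: cinner_sum orthonormal_def)

lemma cinner_spanned_0:
  assumes "orthonormal N r u" "spanned N r' u v" "r' \<le> j" "j < r"
  shows "cinner N (u j) v = 0"
  using assms cinner_orthonormal_sum_0[OF assms(1,3,4), of "\<lambda>k. cinner N (u k) v"]
  by (auto simp: spanned_def cong: cinner_cong)

lemma spanned_mono:
  assumes on: "orthonormal N r u" and sp: "spanned N r' u v" and le: "r' \<le> r"
  shows "spanned N r u v"
proof -
  have "(\<Sum>j<r. cinner N (u j) v * u j i) = (\<Sum>j<r'. cinner N (u j) v * u j i)" for i
    using le cinner_spanned_0[OF on sp] by (intro sum.mono_neutral_right) auto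
  then show ?thesis using sp by (simp add: spanned_def)
qed

lemma spannedI:
  assumes on: "orthonormal N r u" and v: "\<And>i. i < N \<Longrightarrow> v i = (\<Sum>j<r. c j * u j i)"
  shows "spanned N r u v"
proof -
  have "cinner N (u j) v = c j" if "j < r" for j
    using cinner_orthonormal_sum[OF on that, of c] v by (simp cong: cinner_cong)
  then show ?thesis using v by (simp add: spanned_def)
qed

lemma spanned_sum:
  assumes "\<And>k. k \<in> K \<Longrightarrow> spanned N r u (f k)"
  shows "spanned N r u (\<lambda>i. \<Sum>k\<in>K. c k * f k i)"
  unfolding spanned_def
proof (intro allI impI)
  fix i assume i: "i < N"
  have "(\<Sum>k\<in>K. c k * f k i) = (\<Sum>k\<in>K. c k * (\<Sum>j<r. cinner N (u j) (f k) * u j i))"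
    using assms i by (intro sum.cong) (auto simp: spanned_def)
  also have "\<dots> = (\<Sum>j<r. cinner N (u j) (\<lambda>i. \<Sum>k\<in>K. c k * f k i) * u j i)"
    unfolding cinner_sum sum_distrib_left sum_distrib_right
    by (subst sum.swap) (simp add: mult.assoc)
  finally show "(\<Sum>k\<in>K. c k * f k i) = \<dots>" .
qed

lemma sqnorm_orthonormal_sum:
  assumes "orthonormal N r u"
  shows "sqnorm N (\<lambda>i. \<Sum>j<r. c j * u j i) = (\<Sum>j<r. (cmod (c j))\<^sup>2)"
proof -
  let ?v = "\<lambda>i. \<Sum>j<r. c j * u j i"
  have "complex_of_real (sqnorm N ?v) = (\<Sum>j<r. c j * cinner N ?v (u j))"
    unfolding cinner_self[symmetric] by (rule cinner_sum)
  also have "\<dots> = (\<Sum>j<r. c j * cnj (c j))"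
    using cinner_orthonormal_sum[OF assms, of _ c]
    by (intro sum.cong) (auto simp: cnj_cinner[of N "u _" ?v, symmetric])
  also have "\<dots> = complex_of_real (\<Sum>j<r. (cmod (c j))\<^sup>2)"
    by (simp add: complex_norm_square del: of_real_power)
  finally show ?thesis using of_real_eq_iff by blast
qed

lemma sqnorm_spanned:
  assumes "orthonormal N r u" "spanned N r u v"
  shows "sqnorm N v = (\<Sum>j<r. (cmod (cinner N (u j) v))\<^sup>2)"
proof -
  have "sqnorm N v = sqnorm N (\<lambda>i. \<Sum>j<r. cinner N (u j) v * u j i)"
    using assms(2) by (simp add: sqnorm_def spanned_def)
  then show ?thesis using sqnorm_orthonormal_sum[OF assms(1)] by simp
qed

text \<open>\<open>Q\<close> is any property of vectors closed under linear combinations; taking \<open>Q\<close> to be membership in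
  the span of the \<open>f k\<close> shows that the new vectors do not leave that span.\<close>

lemma gram_schmidt:
  fixes f :: "'k \<Rightarrow> nat \<Rightarrow> complex"
  assumes "finite K" and "orthonormal N r u"
    and "\<And>v w c. Q v \<Longrightarrow> Q w \<Longrightarrow> Q (\<lambda>i. v i + c * w i)" and "Q (\<lambda>_. 0)"
    and "\<And>j. j < r \<Longrightarrow> Q (u j)" and "\<And>k. k \<in> K \<Longrightarrow> Q (f k)"
  shows "\<exists>r' u'. r \<le> r' \<and> r' \<le> r + card K \<and> (\<forall>j<r. u' j = u j) \<and> orthonormal N r' u' \<and>
           (\<forall>k\<in>K. spanned N r' u' (f k)) \<and> (\<forall>j<r'. Q (u' j))"
  using assms(1,6)
proof (induction K)
  case empty
  then show ?case using assms by (intro exI[of _ r] exI[of _ u]) auto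
next
  case (insert k K)
  then obtain r1 u1 where r1: "r \<le> r1" "r1 \<le> r + card K" "\<forall>j<r. u1 j = u j"
    and on: "orthonormal N r1 u1" and sp: "\<forall>k\<in>K. spanned N r1 u1 (f k)" and q: "\<forall>j<r1. Q (u1 j)"
    by auto
  define w where "w = (\<lambda>i. f k i - (\<Sum>j<r1. cinner N (u1 j) (f k) * u1 j i))"
  show ?case
  proof (cases "sqnorm N w = 0")
    case True
    then have "w i = 0" if "i < N" for i using sqnorm_zero_imp that by blast
    then have "spanned N r1 u1 (f k)"
      unfolding spanned_def w_def by auto
    then show ?thesis using r1 on sp q insert(1,2) by (intro exI[of _ r1] exI[of _ u1]) auto
  next
    case False
    define s where "s = sqrt (sqnorm N w)"
    have s: "s \<noteq> 0" using False by (simp add: s_def)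
    have s2: "of_real (sqnorm N w) = complex_of_real s * complex_of_real s"
      unfolding of_real_mult[symmetric] s_def by simp
    define u2 where "u2 = u1(r1 := (\<lambda>i. (1 / of_real s) * w i))"
    have u2: "u2 j = u1 j" if "j < r1" for j using that by (simp add: u2_def)
    have u2r: "u2 r1 = (\<lambda>i. (1 / of_real s) * w i)" by (simp add: u2_def)
    have orth: "cinner N (u1 j) w = 0" if "j < r1" for j
      unfolding w_def cinner_diff using cinner_orthonormal_sum[OF on that] by simp
    then have orth': "cinner N w (u1 j) = 0" if "j < r1" for j
      using that cnj_cinner[of N "u1 j" w] by simp
    have c1: "cinner N (u2 r1) v = 1 / of_real s * cinner N w v" for v
      using cnj_cinner[of N v "u2 r1"] cnj_cinner[of N v w] unfolding u2r cinner_scale by simp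
    have on2: "orthonormal N (Suc r1) u2"
      unfolding orthonormal_def
    proof (intro allI impI)
      fix j l assume jl: "j < Suc r1" "l < Suc r1"
      consider "j < r1" "l < r1" | "j < r1" "l = r1" | "j = r1" "l < r1" | "j = r1" "l = r1"
        using jl by linarith
      then show "cinner N (u2 j) (u2 l) = of_bool (j = l)"
      proof cases
        case 1 then show ?thesis using on by (simp add: u2 orthonormal_def)
      next
        case 2 then show ?thesis by (simp only: u2 u2r cinner_scale orth) simp
      next
        case 3 then show ?thesis by (simp only: c1 u2 orth') simp
      next
        case 4
        then show ?thesis
          unfolding 4 c1 unfolding u2r cinner_scale cinner_self using s2 s by simp
      qed
    qed
    have sp2: "spanned N (Suc r1) u2 v" if "spanned N r1 u1 v" for v
    proof (rule spanned_mono[OF on2])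
      show "spanned N r1 u2 v" using that by (simp add: spanned_def u2)
    qed simp
    have "spanned N (Suc r1) u2 (f k)"
    proof (rule spannedI[OF on2, where c = "\<lambda>j. if j < r1 then cinner N (u1 j) (f k) else of_real s"])
      fix i
      have "f k i = (\<Sum>j<r1. cinner N (u1 j) (f k) * u1 j i) + w i" by (simp add: w_def)
      then show "f k i = (\<Sum>j<Suc r1. (if j < r1 then cinner N (u1 j) (f k) else of_real s) * u2 j i)"
        using s by (simp add: u2 u2r)
    qed
    moreover have "Q (u2 j)" if "j < Suc r1" for j
    proof (cases "j < r1")
      case True then show ?thesis using q u2 by simp
    next
      case False
      \<comment> \<open>\<open>Q\<close> is closed under adding one multiple at a time, so the
        projection is subtracted term by term.\<close>
      have "Q (\<lambda>i. f k i - (\<Sum>j<m. c j * u1 j i))" if "m \<le> r1" for m c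
        using that
      proof (induction m)
        case 0 then show ?case using insert.prems by simp
      next
        case (Suc m)
        then have "Q (\<lambda>i. (f k i - (\<Sum>j<m. c j * u1 j i)) + (- c m) * u1 m i)"
          using q by (intro assms(3)) auto
        then show ?case by (simp add: algebra_simps)
      qed
      from this[of r1] have "Q w" by (simp add: w_def)
      \<comment> \<open>Scaling is the closure property applied to the zero vector and
        \<open>w\<close>.\<close>
      from assms(3)[OF assms(4) this, of "1 / of_real s"] have "Q (u2 r1)" unfolding u2r by (simp del: times_divide_eq_left)
      then show ?thesis using False that less_antisym by blast
    qed
    ultimately show ?thesis
      using r1 on2 sp sp2 insert(1,2) u2
      by (intro exI[of _ "Suc r1"] exI[of _ u2]) auto
  qed
qed

text \<open>Gram-Schmidt on the standard basis. That exactly \<open>N\<close> vectors result is a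
  double count of all \<open>|u' j k|^2\<close>: for fixed \<open>k\<close> they sum to 1 because
  the \<open>k\<close>-th standard vector is spanned, for fixed \<open>j\<close> because
  \<open>u' j\<close> is normalised. The inequality \<open>r \<le> N\<close> follows from the same
  count.\<close>

lemma orthonormal_completion:
  assumes on: "orthonormal N r u"
  shows "\<exists>u'. r \<le> N \<and> (\<forall>j<r. u' j = u j) \<and> orthonormal N N u' \<and> (\<forall>v. spanned N N u' v)"
proof -
  let ?e = "\<lambda>k i. of_bool (i = k) :: complex"
  obtain r' u' where r': "r \<le> r'" "\<forall>j<r. u' j = u j" "orthonormal N r' u'"
    and sp: "\<And>k. k < N \<Longrightarrow> spanned N r' u' (?e k)"
    using gram_schmidt[OF _ on, of "{..<N}" "\<lambda>_. True" ?e] by auto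
  have ce: "cinner N w (?e k) = cnj (w k)" if "k < N" for w k
    using that by (simp add: cinner_def of_bool_def if_distrib cong: if_cong)
  have "(\<Sum>j<r'. (cmod (u' j k))\<^sup>2) = 1" if "k < N" for k
  proof -
    have "1 = (\<Sum>j<r'. cnj (u' j k) * u' j k)"
      using sp[OF that] ce[OF that] that by (auto simp: spanned_def)
    also have "\<dots> = complex_of_real (\<Sum>j<r'. (cmod (u' j k))\<^sup>2)"
      by (simp add: complex_norm_square mult.commute del: of_real_power)
    finally show ?thesis by (metis of_real_eq_1_iff)
  qed
  then have "real N = (\<Sum>k<N. \<Sum>j<r'. (cmod (u' j k))\<^sup>2)" by simp
  also have "\<dots> = (\<Sum>j<r'. sqnorm N (u' j))"
    unfolding sqnorm_def by (rule sum.swap)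
  also have "\<dots> = real r'"
  proof -
    have "complex_of_real (sqnorm N (u' j)) = 1" if "j < r'" for j
      using r'(3) that unfolding cinner_self[symmetric] orthonormal_def by simp
    then show ?thesis by simp
  qed
  finally have N: "r' = N" by simp
  have "spanned N N u' v" for v
  proof -
    have "spanned N r' u' (\<lambda>i. \<Sum>k<N. v k * ?e k i)"
      using sp by (intro spanned_sum) auto
    moreover have "(\<Sum>k<N. v k * ?e k i) = v i" if "i < N" for i
      using that by (simp add: of_bool_def if_distrib cong: if_cong)
    ultimately show ?thesis unfolding N spanned_def by (simp cong: cinner_cong)
  qed
  then show ?thesis using r' N by blast
qed

section \<open>Integrals over independent Gaussian coordinates\<close>

lemma prod_ennreal_exp: "finite I \<Longrightarrow> (\<Prod>i\<in>I. ennreal (exp (f i))) = ennreal (exp (\<Sum>i\<in>I. f i))"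
  by (simp add: exp_sum prod_ennreal)

lemma product_sigma_finite_complex_gaussian:
  "0 < v \<Longrightarrow> product_sigma_finite (\<lambda>_. complex_gaussian v)"
  by (simp add: product_sigma_finite_def prob_space_complex_gaussian prob_space_imp_sigma_finite)

lemma sigma_finite_PiM_complex_gaussian:
  "0 < v \<Longrightarrow> sigma_finite_measure (\<Pi>\<^sub>M i\<in>I. complex_gaussian v)"
  by (intro prob_space_imp_sigma_finite prob_space_PiM prob_space_complex_gaussian)

lemma sets_PiM_complex_gaussian [measurable_cong]:
  "sets (\<Pi>\<^sub>M i\<in>I. complex_gaussian v) = sets (\<Pi>\<^sub>M i\<in>I. borel)"
  by (intro sets_PiM_cong) auto

text \<open>Induction over the matrix entries. Integrating out the entry \<open>e\<close> changes
  the weight of its own row only; this is why the weights \<open>t\<close> vary with the row and are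
  generalised in the induction.\<close>

lemma nn_integral_gaussian_exp_rows:
  fixes x :: "'e \<Rightarrow> complex" and row :: "'e \<Rightarrow> nat"
  assumes "finite E" and "\<And>i. 0 \<le> t i"
  shows "(\<integral>\<^sup>+\<omega>. ennreal (exp (\<Sum>i<N. - t i * (cmod (w i + (\<Sum>e | e \<in> E \<and> row e = i. x e * \<omega> e)))\<^sup>2))
            \<partial>(\<Pi>\<^sub>M e\<in>E. complex_gaussian 1))
       = (\<Prod>i<N. ennreal (exp (- (t i / (1 + t i * (\<Sum>e | e \<in> E \<and> row e = i. (cmod (x e))\<^sup>2))) * (cmod (w i))\<^sup>2)
            / (1 + t i * (\<Sum>e | e \<in> E \<and> row e = i. (cmod (x e))\<^sup>2))))"
    (is "?L E t = ?R E t")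
  using assms
proof (induction E arbitrary: t)
  case empty
  interpret prob_space "\<Pi>\<^sub>M e\<in>({} :: 'e set). complex_gaussian 1"
    by (intro prob_space_PiM prob_space_complex_gaussian) simp
  show ?case by (simp add: prod_ennreal_exp emeasure_space_1)
next
  case (insert e E)
  interpret product_sigma_finite "\<lambda>_ :: 'e. complex_gaussian 1"
    by (rule product_sigma_finite_complex_gaussian) simp
  define k where "k = 1 + t (row e) * (cmod (x e))\<^sup>2"
  have k: "1 \<le> k" using insert.prems by (simp add: k_def)
  define t' where "t' = t (row e := t (row e) / k)"
  have t': "0 \<le> t' i" for i using insert.prems k by (simp add: t'_def)
  let ?S = "\<lambda>\<omega> i. w i + (\<Sum>e' | e' \<in> E \<and> row e' = i. x e' * \<omega> e')"
  have set_eq: "{e'. e' \<in> insert e E \<and> row e' = i} =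
      (if i = row e then insert e {e' \<in> E. row e' = i} else {e' \<in> E. row e' = i})" for i
    by auto
  have upd: "(\<Sum>e' | e' \<in> E \<and> row e' = i. x e' * fun_upd \<omega> e y e') = (\<Sum>e' | e' \<in> E \<and> row e' = i. x e' * \<omega> e')" for i \<omega> y
    using insert.hyps by (intro sum.cong) auto
  have upd': "(\<Sum>e' | e' \<in> insert e E \<and> row e' = i. x e' * fun_upd \<omega> e y e')
      = (if i = row e then x e * y else 0) + (\<Sum>e' | e' \<in> E \<and> row e' = i. x e' * \<omega> e')" for i \<omega> y
    unfolding set_eq using insert.hyps upd by simp
  have V: "(\<Sum>e' | e' \<in> insert e E \<and> row e' = i. (cmod (x e'))\<^sup>2)
      = (if i = row e then (cmod (x e))\<^sup>2 else 0) + (\<Sum>e' | e' \<in> E \<and> row e' = i. (cmod (x e'))\<^sup>2)" for i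
    unfolding set_eq using insert.hyps by simp
  let ?rest = "\<lambda>\<omega>. (\<Sum>i\<in>{..<N} - {row e}. - t i * (cmod (?S \<omega> i))\<^sup>2)"
  have "?L (insert e E) t = (\<integral>\<^sup>+\<omega>. (\<integral>\<^sup>+y. ennreal (exp (\<Sum>i<N. - t i *
      (cmod (w i + (\<Sum>e' | e' \<in> insert e E \<and> row e' = i. x e' * fun_upd \<omega> e y e')))\<^sup>2))
            \<partial>complex_gaussian 1) \<partial>(\<Pi>\<^sub>M e\<in>E. complex_gaussian 1))"
    using insert.hyps by (intro product_nn_integral_insert) measurable
  also have "\<dots> = (\<integral>\<^sup>+\<omega>. (if row e < N then ennreal (1 / k) else 1) *
         ennreal (exp (\<Sum>i<N. - t' i * (cmod (?S \<omega> i))\<^sup>2)) \<partial>(\<Pi>\<^sub>M e\<in>E. complex_gaussian 1))"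
  proof (intro nn_integral_cong)
    fix \<omega> :: "'e \<Rightarrow> complex"
    show "(\<integral>\<^sup>+y. ennreal (exp (\<Sum>i<N. - t i *
      (cmod (w i + (\<Sum>e' | e' \<in> insert e E \<and> row e' = i. x e' * fun_upd \<omega> e y e')))\<^sup>2))
            \<partial>complex_gaussian 1) = (if row e < N then ennreal (1 / k) else 1) *
         ennreal (exp (\<Sum>i<N. - t' i * (cmod (?S \<omega> i))\<^sup>2))"
    proof (cases "row e < N")
      case True
      have sp: "(\<Sum>i<N. f i) = f (row e) + (\<Sum>i\<in>{..<N} - {row e}. f i)" for f :: "nat \<Rightarrow> real"
        using True by (subst sum.remove[of _ "row e"]) auto
      have "(\<integral>\<^sup>+y. ennreal (exp (\<Sum>i<N. - t i *
          (cmod (w i + (\<Sum>e' | e' \<in> insert e E \<and> row e' = i. x e' * fun_upd \<omega> e y e')))\<^sup>2)) \<partial>complex_gaussian 1)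
        = (\<integral>\<^sup>+y. ennreal (exp (?rest \<omega>)) *
             ennreal (exp (- t (row e) * (cmod (?S \<omega> (row e) + x e * y))\<^sup>2)) \<partial>complex_gaussian 1)"
        unfolding upd' sp exp_add
        by (intro nn_integral_cong) (simp add: algebra_simps flip: ennreal_mult)
      also have "\<dots> = ennreal (exp (?rest \<omega>)) * ennreal (exp (- (t (row e) / k) * (cmod (?S \<omega> (row e)))\<^sup>2) / k)"
        unfolding k_def
        by (subst nn_integral_cmult, measurable)
          (simp only: nn_integral_complex_gaussian_exp_shift[OF insert.prems])
      also have "\<dots> = ennreal (1 / k) * ennreal (exp (\<Sum>i<N. - t' i * (cmod (?S \<omega> i))\<^sup>2))"
        unfolding sp exp_add using k
        by (simp add: t'_def mult.commute flip: ennreal_mult)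
      finally show ?thesis using True by simp
    next
      \<comment> \<open>The entry lies outside the first \<open>N\<close> rows, does not occur in
        the exponent and integrates to 1.\<close>
      case False
      interpret prob_space "complex_gaussian 1" by (rule prob_space_complex_gaussian) simp
      have "i \<noteq> row e" if "i < N" for i using that False by auto
      then show ?thesis
        using False emeasure_space_1 unfolding upd' by (simp add: t'_def)
    qed
  qed
  also have "\<dots> = (if row e < N then ennreal (1 / k) else 1) * ?L E t'"
    by (rule nn_integral_cmult) measurable
  also have "?L E t' = ?R E t'"
    using t' by (rule insert.IH)
  also have "(if row e < N then ennreal (1 / k) else 1) * ?R E t' = ?R (insert e E) t"
  proof -
    define V0 where "V0 = (\<lambda>i. \<Sum>e' | e' \<in> E \<and> row e' = i. (cmod (x e'))\<^sup>2)"
    have V0: "0 \<le> V0 i" for i by (simp add: V0_def sum_nonneg)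
    \<comment> \<open>Composition law of the weights: absorbing \<open>x e\<close> first and the
      other entries of the row afterwards amounts to absorbing all of them at once.\<close>
    have kk: "1 + t (row e) * ((cmod (x e))\<^sup>2 + V0 (row e)) = k * (1 + t (row e) / k * V0 (row e))"
      using k by (simp add: k_def field_simps)
    have main: "ennreal (1 / k) * ennreal (exp (- (t (row e) / k / (1 + t (row e) / k * V0 (row e))) * a)
                 / (1 + t (row e) / k * V0 (row e)))
        = ennreal (exp (- (t (row e) / (1 + t (row e) * ((cmod (x e))\<^sup>2 + V0 (row e)))) * a)
                 / (1 + t (row e) * ((cmod (x e))\<^sup>2 + V0 (row e))))" for a
    proof -
      have "0 < 1 + t (row e) / k * V0 (row e)"
        using k insert.prems V0 by (intro add_pos_nonneg mult_nonneg_nonneg divide_nonneg_nonneg) auto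
      then show ?thesis unfolding kk using k by (simp flip: ennreal_mult)
    qed
    show ?thesis
    proof (cases "row e < N")
      case True
      have pr: "(\<Prod>i<N. f i) = f (row e) * (\<Prod>i\<in>{..<N} - {row e}. f i)" for f :: "nat \<Rightarrow> ennreal"
        using True by (subst prod.remove[of _ "row e"]) auto
      define F where "F = (\<lambda>i t V. ennreal (exp (- (t / (1 + t * V)) * (cmod (w i))\<^sup>2) / (1 + t * V)))"
      have "ennreal (1 / k) * (\<Prod>i<N. F i (t' i) (V0 i))
          = ennreal (1 / k) * F (row e) (t (row e) / k) (V0 (row e)) * (\<Prod>i\<in>{..<N} - {row e}. F i (t' i) (V0 i))"
        unfolding pr by (simp add: t'_def mult.assoc)
      also have "ennreal (1 / k) * F (row e) (t (row e) / k) (V0 (row e))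
          = F (row e) (t (row e)) ((cmod (x e))\<^sup>2 + V0 (row e))"
        unfolding F_def by (rule main)
      also have "(\<Prod>i\<in>{..<N} - {row e}. F i (t' i) (V0 i))
          = (\<Prod>i\<in>{..<N} - {row e}. F i (t i) ((if i = row e then (cmod (x e))\<^sup>2 else 0) + V0 i))"
        by (intro prod.cong) (auto simp: t'_def)
      also have "F (row e) (t (row e)) ((cmod (x e))\<^sup>2 + V0 (row e)) * \<dots>
          = (\<Prod>i<N. F i (t i) ((if i = row e then (cmod (x e))\<^sup>2 else 0) + V0 i))"
        unfolding pr by simp
      finally show ?thesis using True unfolding V F_def V0_def by simp
    next
      case False
      have "i \<noteq> row e" if "i < N" for i using that False by auto
      then show ?thesis using False unfolding V by (simp add: t'_def)
    qed
  qed
  finally show ?case .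
qed

section \<open>Quadratic forms of Gaussian vectors\<close>

lemma borel_measurable_cnj [measurable]: "cnj \<in> borel_measurable borel"
  by (intro borel_measurable_continuous_onI continuous_intros)

lemma nn_integral_gaussian_columns:
  fixes x :: "nat \<Rightarrow> complex"
  assumes S: "finite S" and s: "0 \<le> s"
  shows "(\<integral>\<^sup>+\<omega>. ennreal (exp (- s * sqnorm N (\<lambda>i. w i + (\<Sum>j\<in>S. x j * \<omega> (i, j)))))
            \<partial>(\<Pi>\<^sub>M e\<in>{..<N} \<times> S. complex_gaussian 1))
       = ennreal (exp (- (s / (1 + s * (\<Sum>j\<in>S. (cmod (x j))\<^sup>2))) * sqnorm N w)
            / (1 + s * (\<Sum>j\<in>S. (cmod (x j))\<^sup>2)) ^ N)"
proof -
  have row: "(\<Sum>e | e \<in> {..<N} \<times> S \<and> fst e = i. f e) = (\<Sum>j\<in>S. f (i, j))" if "i < N"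
    for f :: "nat \<times> nat \<Rightarrow> 'a :: comm_monoid_add" and i
  proof -
    have "{e. e \<in> {..<N} \<times> S \<and> fst e = i} = Pair i ` S" using that by auto
    then show ?thesis by (simp add: sum.reindex inj_on_def)
  qed
  define k where "k = 1 + s * (\<Sum>j\<in>S. (cmod (x j))\<^sup>2)"
  have k: "0 < k" unfolding k_def using s by (intro add_pos_nonneg mult_nonneg_nonneg sum_nonneg) auto
  have "(\<integral>\<^sup>+\<omega>. ennreal (exp (- s * sqnorm N (\<lambda>i. w i + (\<Sum>j\<in>S. x j * \<omega> (i, j)))))
            \<partial>(\<Pi>\<^sub>M e\<in>{..<N} \<times> S. complex_gaussian 1))
      = (\<integral>\<^sup>+\<omega>. ennreal (exp (\<Sum>i<N. - s * (cmod (w i +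
            (\<Sum>e | e \<in> {..<N} \<times> S \<and> fst e = i. x (snd e) * \<omega> e)))\<^sup>2)) \<partial>(\<Pi>\<^sub>M e\<in>{..<N} \<times> S. complex_gaussian 1))"
    by (simp add: row sqnorm_def sum_distrib_left)
  also have "\<dots> = (\<Prod>i<N. ennreal (exp (- (s / k) * (cmod (w i))\<^sup>2) / k))"
    using S s by (subst nn_integral_gaussian_exp_rows) (auto simp: row k_def)
  also have "\<dots> = ennreal (\<Prod>i<N. exp (- (s / k) * (cmod (w i))\<^sup>2) / k)"
    using k by (intro prod_ennreal) auto
  also have "(\<Prod>i<N. exp (- (s / k) * (cmod (w i))\<^sup>2) / k) = exp (- (s / k) * sqnorm N w) / k ^ N"
    by (simp add: prod_dividef sqnorm_def sum_distrib_left exp_sum)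
  finally show ?thesis unfolding k_def .
qed

text \<open>Used in both directions. Read from right to left with \<open>s = 0\<close>, it writes
  the exponential of a sum of squared moduli as an average of exponentials of linear forms.\<close>

lemma nn_integral_PiM_gaussian_exp_quadratic:
  assumes "finite J" "0 < v" "\<And>j. j \<in> J \<Longrightarrow> 0 < 1 + s j * v"
  shows "(\<integral>\<^sup>+z. ennreal (exp (\<Sum>j\<in>J. - s j * (cmod (z j))\<^sup>2 + 2 * Re (cnj (q j) * z j)))
            \<partial>(\<Pi>\<^sub>M j\<in>J. complex_gaussian v))
       = (\<Prod>j\<in>J. ennreal (exp (v * (cmod (q j))\<^sup>2 / (1 + s j * v)) / (1 + s j * v)))"
proof -
  interpret product_sigma_finite "\<lambda>_. complex_gaussian v"
    using assms(2) by (rule product_sigma_finite_complex_gaussian)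
  have "(\<integral>\<^sup>+z. ennreal (exp (\<Sum>j\<in>J. - s j * (cmod (z j))\<^sup>2 + 2 * Re (cnj (q j) * z j)))
            \<partial>(\<Pi>\<^sub>M j\<in>J. complex_gaussian v))
      = (\<integral>\<^sup>+z. (\<Prod>j\<in>J. ennreal (exp (- s j * (cmod (z j))\<^sup>2 + 2 * Re (cnj (q j) * z j))))
            \<partial>(\<Pi>\<^sub>M j\<in>J. complex_gaussian v))"
    using assms(1) by (simp add: prod_ennreal_exp)
  also have "\<dots> = (\<Prod>j\<in>J. \<integral>\<^sup>+z. ennreal (exp (- s j * (cmod z)\<^sup>2 + 2 * Re (cnj (q j) * z))) \<partial>complex_gaussian v)"
    using assms(1) by (subst product_nn_integral_prod) auto
  also have "\<dots> = (\<Prod>j\<in>J. ennreal (exp (v * (cmod (q j))\<^sup>2 / (1 + s j * v)) / (1 + s j * v)))"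
    using assms by (intro prod.cong refl nn_integral_complex_gaussian_exp_quadratic) auto
  finally show ?thesis .
qed

text \<open>The joint moment generating function of the squared coordinates of \<open>n\<close>
  along \<open>u\<close>, which unitary invariance would make independent. Here an auxiliary
  \<open>z\<close> makes the exponent linear in \<open>n\<close>, the coordinates of
  \<open>n\<close> are integrated out, and \<open>z\<close> is integrated with the negative
  parameter \<open>- (v * c j)\<close>; this last integral converges because
  \<open>v * c j < 1\<close>.\<close>

lemma nn_integral_gaussian_exp_orthonormal:
  assumes on: "orthonormal N r u" and v: "0 < v"
    and c: "\<And>j. j < r \<Longrightarrow> 0 \<le> c j" "\<And>j. j < r \<Longrightarrow> v * c j < 1"
  shows "(\<integral>\<^sup>+n. ennreal (exp (\<Sum>j<r. c j * (cmod (cinner N (u j) n))\<^sup>2))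
            \<partial>(\<Pi>\<^sub>M i\<in>{..<N}. complex_gaussian v))
       = ennreal (\<Prod>j<r. 1 / (1 - v * c j))"
proof -
  let ?P = "\<Pi>\<^sub>M i\<in>{..<N}. complex_gaussian v" and ?Z = "\<Pi>\<^sub>M j\<in>{..<r}. complex_gaussian 1"
  let ?q = "\<lambda>z i. \<Sum>j<r. (of_real (sqrt (c j)) * z j) * u j i"
  interpret P: sigma_finite_measure ?P using v by (rule sigma_finite_PiM_complex_gaussian)
  interpret Z: sigma_finite_measure ?Z by (rule sigma_finite_PiM_complex_gaussian) simp
  interpret PZ: pair_sigma_finite ?P ?Z ..
  have re: "(\<Sum>j<r. Re (cnj (of_real (sqrt (c j)) * cinner N (u j) n) * z j)) = (\<Sum>i<N. Re (cnj (?q z i) * n i))"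
    for n z
  proof -
    have "(\<Sum>j<r. Re (cnj (of_real (sqrt (c j)) * cinner N (u j) n) * z j))
        = Re (cnj (\<Sum>j<r. of_real (sqrt (c j)) * cinner N (u j) n * cnj (z j)))"
      by (simp add: Re_sum)
    also have "\<dots> = Re (\<Sum>j<r. \<Sum>i<N. of_real (sqrt (c j)) * cnj (u j i) * n i * cnj (z j))"
      unfolding cnj.simps(1) cinner_def by (simp add: sum_distrib_left sum_distrib_right mult.assoc)
    also have "(\<Sum>j<r. \<Sum>i<N. of_real (sqrt (c j)) * cnj (u j i) * n i * cnj (z j))
        = (\<Sum>i<N. cnj (?q z i) * n i)"
      by (subst sum.swap) (simp add: sum_distrib_left sum_distrib_right mult_ac)
    finally show ?thesis by (simp add: Re_sum)
  qed
  have "(\<integral>\<^sup>+n. ennreal (exp (\<Sum>j<r. c j * (cmod (cinner N (u j) n))\<^sup>2)) \<partial>?P)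
      = (\<integral>\<^sup>+n. \<integral>\<^sup>+z. ennreal (exp (\<Sum>i<N. 2 * Re (cnj (?q z i) * n i))) \<partial>?Z \<partial>?P)"
  proof (intro nn_integral_cong)
    fix n
    have "ennreal (exp (\<Sum>j<r. c j * (cmod (cinner N (u j) n))\<^sup>2))
        = (\<Prod>j<r. ennreal (exp (1 * (cmod (of_real (sqrt (c j)) * cinner N (u j) n))\<^sup>2 / (1 + 0 * 1)) / (1 + 0 * 1)))"
      using c(1) by (simp add: prod_ennreal_exp norm_mult power_mult_distrib)
    also have "\<dots> = (\<integral>\<^sup>+z. ennreal (exp (\<Sum>j<r. - 0 * (cmod (z j))\<^sup>2
         + 2 * Re (cnj (of_real (sqrt (c j)) * cinner N (u j) n) * z j))) \<partial>?Z)"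
      by (intro nn_integral_PiM_gaussian_exp_quadratic[symmetric]) auto
    also have "\<dots> = (\<integral>\<^sup>+z. ennreal (exp (\<Sum>i<N. 2 * Re (cnj (?q z i) * n i))) \<partial>?Z)"
      by (simp only: minus_zero mult_zero_left add_0 sum_distrib_left[symmetric] re)
    finally show "ennreal (exp (\<Sum>j<r. c j * (cmod (cinner N (u j) n))\<^sup>2)) = \<dots>" .
  qed
  also have "\<dots> = (\<integral>\<^sup>+z. \<integral>\<^sup>+n. ennreal (exp (\<Sum>i<N. 2 * Re (cnj (?q z i) * n i))) \<partial>?P \<partial>?Z)"
    by (rule PZ.Fubini'[symmetric]) measurable
  also have "\<dots> = (\<integral>\<^sup>+z. ennreal (exp (\<Sum>j<r. - (- (v * c j)) * (cmod (z j))\<^sup>2 + 2 * Re (cnj 0 * z j))) \<partial>?Z)"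
  proof (intro nn_integral_cong)
    fix z
    have "(\<integral>\<^sup>+n. ennreal (exp (\<Sum>i<N. 2 * Re (cnj (?q z i) * n i))) \<partial>?P)
        = (\<integral>\<^sup>+n. ennreal (exp (\<Sum>i<N. - 0 * (cmod (n i))\<^sup>2 + 2 * Re (cnj (?q z i) * n i))) \<partial>?P)"
      by simp
    also have "\<dots> = (\<Prod>i<N. ennreal (exp (v * (cmod (?q z i))\<^sup>2 / (1 + 0 * v)) / (1 + 0 * v)))"
      using v by (intro nn_integral_PiM_gaussian_exp_quadratic) auto
    also have "\<dots> = ennreal (exp (v * sqnorm N (?q z)))"
      by (simp add: prod_ennreal_exp sqnorm_def sum_distrib_left)
    \<comment> \<open>Orthonormality enters here: it makes the exponent left after integrating out
      \<open>n\<close> diagonal in \<open>z\<close>.\<close>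
    also have "sqnorm N (?q z) = (\<Sum>j<r. c j * (cmod (z j))\<^sup>2)"
      using c(1) by (subst sqnorm_orthonormal_sum[OF on]) (simp add: norm_mult power_mult_distrib)
    finally show "(\<integral>\<^sup>+n. ennreal (exp (\<Sum>i<N. 2 * Re (cnj (?q z i) * n i))) \<partial>?P)
        = ennreal (exp (\<Sum>j<r. - (- (v * c j)) * (cmod (z j))\<^sup>2 + 2 * Re (cnj 0 * z j)))"
      by (simp add: sum_distrib_left mult.assoc)
  qed
  also have "\<dots> = (\<Prod>j<r. ennreal (exp (1 * (cmod 0)\<^sup>2 / (1 + - (v * c j) * 1)) / (1 + - (v * c j) * 1)))"
    using c by (intro nn_integral_PiM_gaussian_exp_quadratic) auto
  also have "\<dots> = ennreal (\<Prod>j<r. 1 / (1 - v * c j))"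
    using c(2) by (subst prod_ennreal) (auto simp: less_imp_le)
  finally show ?thesis .
qed

text \<open>Parseval in a complete basis: subtracting an element of the span of the first
  \<open>b\<close> vectors leaves the later coordinates alone. The best choice of \<open>d\<close>
  leaves just the tail from \<open>b\<close> on, so this tail is the squared distance to that
  span.\<close>

lemma sqnorm_diff_orthonormal_sum:
  assumes on: "orthonormal N N u" and sp: "\<And>v. spanned N N u v" and b: "b \<le> N"
  shows "sqnorm N (\<lambda>i. v i - (\<Sum>j<b. d j * u j i))
       = (\<Sum>j=b..<N. (cmod (cinner N (u j) v))\<^sup>2) + (\<Sum>j<b. (cmod (cinner N (u j) v - d j))\<^sup>2)"
proof -
  have on': "orthonormal N b u" using on b by (rule orthonormal_mono)
  have "sqnorm N (\<lambda>i. v i - (\<Sum>j<b. d j * u j i))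
      = (\<Sum>j<N. (cmod (cinner N (u j) v - cinner N (u j) (\<lambda>i. \<Sum>j<b. d j * u j i)))\<^sup>2)"
    by (simp add: sqnorm_spanned[OF on sp] cinner_diff)
  also have "\<dots> = (\<Sum>j<b. (cmod (cinner N (u j) v - cinner N (u j) (\<lambda>i. \<Sum>j<b. d j * u j i)))\<^sup>2)
      + (\<Sum>j=b..<N. (cmod (cinner N (u j) v - cinner N (u j) (\<lambda>i. \<Sum>j<b. d j * u j i)))\<^sup>2)"
    using b by (simp add: lessThan_atLeast0 sum.atLeastLessThan_concat)
  also have "\<dots> = (\<Sum>j<b. (cmod (cinner N (u j) v - d j))\<^sup>2) + (\<Sum>j=b..<N. (cmod (cinner N (u j) v))\<^sup>2)"
    by (simp add: cinner_orthonormal_sum[OF on'] cinner_orthonormal_sum_0[OF on])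
  finally show ?thesis by simp
qed

text \<open>This identity trades the distance to a subspace for an average of distances to its points, which
  are sums over independent coordinates. With two different values of \<open>\<rho>\<close> it introduces and then
  removes the auxiliary Gaussian vector \<open>z\<close>.\<close>

lemma nn_integral_gaussian_projection:
  assumes on: "orthonormal N N u" and sp: "\<And>v. spanned N N u v" and b: "b \<le> N"
    and \<rho>: "0 < \<rho>" and s: "0 < s"
  shows "(\<integral>\<^sup>+z. ennreal (exp ((\<Sum>j<b. (cmod (z j))\<^sup>2)
            - \<rho> * sqnorm N (\<lambda>i. v i - (\<Sum>j<b. (z j / of_real (sqrt s)) * u j i))))
            \<partial>(\<Pi>\<^sub>M j\<in>{..<b}. complex_gaussian 1))
       = ennreal (exp (- \<rho> * (\<Sum>j=b..<N. (cmod (cinner N (u j) v))\<^sup>2)) * (s / \<rho>) ^ b)"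
proof -
  let ?Z = "\<Pi>\<^sub>M j\<in>{..<b}. complex_gaussian 1"
  let ?W = "\<lambda>j. cinner N (u j) v"
  let ?q = "\<lambda>j. of_real (\<rho> / sqrt s) * ?W j"
  let ?D = "\<Sum>j=b..<N. (cmod (cinner N (u j) v))\<^sup>2"
  have e1: "(cmod z)\<^sup>2 - \<rho> * (cmod (w - z / of_real (sqrt s)))\<^sup>2
      = - \<rho> * (cmod w)\<^sup>2 + (- (\<rho> / s - 1) * (cmod z)\<^sup>2 + 2 * Re (cnj (of_real (\<rho> / sqrt s) * w) * z))" for z w
  proof -
    define r where "r = sqrt s"
    have r: "0 < r" "s = r\<^sup>2" using s by (auto simp: r_def)
    show ?thesis
      unfolding r_def[symmetric] cmod_power2 r(2) using r(1)
      by (simp add: Re_divide_of_real Im_divide_of_real power2_eq_square field_simps)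
  qed
  have q2: "(cmod (?q j))\<^sup>2 / (\<rho> / s) = \<rho> * (cmod (?W j))\<^sup>2" for j
    using \<rho> s by (simp add: norm_mult norm_divide power_mult_distrib power_divide) (simp add: power2_eq_square)
  \<comment> \<open>\<open>complex_gaussian 1\<close> has density proportional to
    \<open>exp (- |z|^2)\<close>, which the first term of the exponent cancels. In effect this is a
    Lebesgue integral over the span, which explains both the projection and the power of
    \<open>s / \<rho>\<close>.\<close>
  have "(\<integral>\<^sup>+z. ennreal (exp ((\<Sum>j<b. (cmod (z j))\<^sup>2)
            - \<rho> * sqnorm N (\<lambda>i. v i - (\<Sum>j<b. (z j / of_real (sqrt s)) * u j i)))) \<partial>?Z)
      = (\<integral>\<^sup>+z. ennreal (exp (- \<rho> * ?D - \<rho> * (\<Sum>j<b. (cmod (?W j))\<^sup>2))) *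
           ennreal (exp (\<Sum>j<b. - (\<rho> / s - 1) * (cmod (z j))\<^sup>2 + 2 * Re (cnj (?q j) * z j))) \<partial>?Z)"
  proof (intro nn_integral_cong)
    fix z :: "nat \<Rightarrow> complex"
    have "(\<Sum>j<b. (cmod (z j))\<^sup>2) - \<rho> * sqnorm N (\<lambda>i. v i - (\<Sum>j<b. (z j / of_real (sqrt s)) * u j i))
        = - \<rho> * ?D + (\<Sum>j<b. (cmod (z j))\<^sup>2 - \<rho> * (cmod (?W j - z j / of_real (sqrt s)))\<^sup>2)"
      unfolding sqnorm_diff_orthonormal_sum[OF on sp b]
      by (simp add: distrib_left sum_subtractf sum_distrib_left sum_negf)
    also have "\<dots> = (- \<rho> * ?D - \<rho> * (\<Sum>j<b. (cmod (?W j))\<^sup>2))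
         + (\<Sum>j<b. - (\<rho> / s - 1) * (cmod (z j))\<^sup>2 + 2 * Re (cnj (?q j) * z j))"
      unfolding e1 sum.distrib sum_distrib_left[symmetric] by simp
    finally show "ennreal (exp ((\<Sum>j<b. (cmod (z j))\<^sup>2)
            - \<rho> * sqnorm N (\<lambda>i. v i - (\<Sum>j<b. (z j / of_real (sqrt s)) * u j i))))
        = ennreal (exp (- \<rho> * ?D - \<rho> * (\<Sum>j<b. (cmod (?W j))\<^sup>2))) *
           ennreal (exp (\<Sum>j<b. - (\<rho> / s - 1) * (cmod (z j))\<^sup>2 + 2 * Re (cnj (?q j) * z j)))"
      by (simp only: exp_add ennreal_mult exp_ge_zero)
  qed
  also have "\<dots> = ennreal (exp (- \<rho> * ?D - \<rho> * (\<Sum>j<b. (cmod (?W j))\<^sup>2))) *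
      (\<Prod>j<b. ennreal (exp (1 * (cmod (?q j))\<^sup>2 / (1 + (\<rho> / s - 1) * 1)) / (1 + (\<rho> / s - 1) * 1)))"
    using \<rho> s by (subst nn_integral_cmult, measurable) (subst nn_integral_PiM_gaussian_exp_quadratic, auto)
  also have "(\<Prod>j<b. ennreal (exp (1 * (cmod (?q j))\<^sup>2 / (1 + (\<rho> / s - 1) * 1)) / (1 + (\<rho> / s - 1) * 1)))
      = ennreal (\<Prod>j<b. exp (\<rho> * (cmod (?W j))\<^sup>2) / (\<rho> / s))"
    using \<rho> s q2 by (subst prod_ennreal[symmetric]) auto
  also have "(\<Prod>j<b. exp (\<rho> * (cmod (?W j))\<^sup>2) / (\<rho> / s)) = exp (\<rho> * (\<Sum>j<b. (cmod (?W j))\<^sup>2)) * (s / \<rho>) ^ b"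
    unfolding prod_dividef exp_sum[OF finite_lessThan] sum_distrib_left using \<rho> s by (simp add: field_simps)
  also have "ennreal (exp (- \<rho> * ?D - \<rho> * (\<Sum>j<b. (cmod (?W j))\<^sup>2))) * ennreal (exp (\<rho> * (\<Sum>j<b. (cmod (?W j))\<^sup>2)) * (s / \<rho>) ^ b)
      = ennreal (exp (- \<rho> * ?D) * (s / \<rho>) ^ b)"
  proof -
    have "exp (- \<rho> * ?D - \<rho> * (\<Sum>j<b. (cmod (?W j))\<^sup>2)) * exp (\<rho> * (\<Sum>j<b. (cmod (?W j))\<^sup>2)) = exp (- \<rho> * ?D)"
      by (simp only: exp_add[symmetric]) simp
    then show ?thesis using \<rho> s by (simp only: ennreal_mult'[symmetric] exp_ge_zero mult.assoc[symmetric])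
  qed
  finally show ?thesis .
qed

text \<open>Taking \<open>\<rho> = s\<close> introduces \<open>z\<close> with constant 1, averaging
  over the columns lowers the weight to \<open>s / k\<close>, and \<open>\<rho> = s / k\<close>
  removes \<open>z\<close> again. The removal gains \<open>k ^ b\<close>, which reduces the exponent
  from \<open>N\<close> to \<open>N - b\<close>: only directions orthogonal to the span
  count.\<close>

lemma nn_integral_gaussian_columns_projection:
  fixes x :: "nat \<Rightarrow> complex"
  assumes on: "orthonormal N N u" and sp: "\<And>v. spanned N N u v" and b: "b \<le> N"
    and s: "0 < s" and S: "finite S"
  defines "k \<equiv> 1 + s * (\<Sum>j\<in>S. (cmod (x j))\<^sup>2)"
  shows "(\<integral>\<^sup>+\<omega>. ennreal (exp (- s * (\<Sum>j=b..<N. (cmod (cinner N (u j) (\<lambda>i. p i + (\<Sum>l\<in>S. x l * \<omega> (i, l)))))\<^sup>2)))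
            \<partial>(\<Pi>\<^sub>M e\<in>{..<N} \<times> S. complex_gaussian 1))
       = ennreal (exp (- (s / k) * (\<Sum>j=b..<N. (cmod (cinner N (u j) p))\<^sup>2)) / k ^ (N - b))"
proof -
  let ?A = "\<Pi>\<^sub>M e\<in>{..<N} \<times> S. complex_gaussian 1" and ?Z = "\<Pi>\<^sub>M j\<in>{..<b}. complex_gaussian 1"
  let ?h = "\<lambda>\<omega> i. \<Sum>l\<in>S. x l * \<omega> (i, l)"
  let ?U = "\<lambda>z i. \<Sum>j<b. (z j / of_real (sqrt s)) * u j i"
  interpret A: sigma_finite_measure ?A by (rule sigma_finite_PiM_complex_gaussian) simp
  interpret Z: sigma_finite_measure ?Z by (rule sigma_finite_PiM_complex_gaussian) simp
  interpret AZ: pair_sigma_finite ?A ?Z ..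
  have k: "0 < k" unfolding k_def using s by (intro add_pos_nonneg mult_nonneg_nonneg sum_nonneg) auto
  have "(\<integral>\<^sup>+\<omega>. ennreal (exp (- s * (\<Sum>j=b..<N. (cmod (cinner N (u j) (\<lambda>i. p i + ?h \<omega> i)))\<^sup>2))) \<partial>?A)
      = (\<integral>\<^sup>+\<omega>. \<integral>\<^sup>+z. ennreal (exp ((\<Sum>j<b. (cmod (z j))\<^sup>2)
            - s * sqnorm N (\<lambda>i. p i + ?h \<omega> i - ?U z i))) \<partial>?Z \<partial>?A)"
    using nn_integral_gaussian_projection[OF on sp b s s] s by simp
  also have "\<dots> = (\<integral>\<^sup>+z. \<integral>\<^sup>+\<omega>. ennreal (exp ((\<Sum>j<b. (cmod (z j))\<^sup>2)
            - s * sqnorm N (\<lambda>i. p i + ?h \<omega> i - ?U z i))) \<partial>?A \<partial>?Z)"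
    unfolding sqnorm_def by (rule AZ.Fubini'[symmetric]) measurable
  also have "\<dots> = (\<integral>\<^sup>+z. ennreal (1 / k ^ N) * ennreal (exp ((\<Sum>j<b. (cmod (z j))\<^sup>2)
            - (s / k) * sqnorm N (\<lambda>i. p i - ?U z i))) \<partial>?Z)"
  proof (intro nn_integral_cong)
    fix z :: "nat \<Rightarrow> complex"
    have "(\<integral>\<^sup>+\<omega>. ennreal (exp ((\<Sum>j<b. (cmod (z j))\<^sup>2) - s * sqnorm N (\<lambda>i. p i + ?h \<omega> i - ?U z i))) \<partial>?A)
        = (\<integral>\<^sup>+\<omega>. ennreal (exp (\<Sum>j<b. (cmod (z j))\<^sup>2)) *
             ennreal (exp (- s * sqnorm N (\<lambda>i. (p i - ?U z i) + ?h \<omega> i))) \<partial>?A)"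
      by (intro nn_integral_cong) (simp add: algebra_simps flip: ennreal_mult exp_add)
    also have "\<dots> = ennreal (exp (\<Sum>j<b. (cmod (z j))\<^sup>2)) *
        ennreal (exp (- (s / k) * sqnorm N (\<lambda>i. p i - ?U z i)) / k ^ N)"
      unfolding k_def nn_integral_gaussian_columns[OF S less_imp_le[OF s], symmetric]
      by (rule nn_integral_cmult) (unfold sqnorm_def, measurable)
    also have "\<dots> = ennreal (1 / k ^ N) * ennreal (exp ((\<Sum>j<b. (cmod (z j))\<^sup>2)
            - (s / k) * sqnorm N (\<lambda>i. p i - ?U z i)))"
      unfolding diff_conv_add_uminus exp_add using k by (simp flip: ennreal_mult)
    finally show "(\<integral>\<^sup>+\<omega>. ennreal (exp ((\<Sum>j<b. (cmod (z j))\<^sup>2) - s * sqnorm N (\<lambda>i. p i + ?h \<omega> i - ?U z i))) \<partial>?A) = \<dots>" .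
  qed
  also have "\<dots> = ennreal (1 / k ^ N) * (\<integral>\<^sup>+z. ennreal (exp ((\<Sum>j<b. (cmod (z j))\<^sup>2)
            - (s / k) * sqnorm N (\<lambda>i. p i - ?U z i))) \<partial>?Z)"
    by (rule nn_integral_cmult) (unfold sqnorm_def, measurable)
  also have "(\<integral>\<^sup>+z. ennreal (exp ((\<Sum>j<b. (cmod (z j))\<^sup>2)
            - (s / k) * sqnorm N (\<lambda>i. p i - ?U z i))) \<partial>?Z)
      = ennreal (exp (- (s / k) * (\<Sum>j=b..<N. (cmod (cinner N (u j) p))\<^sup>2)) * (s / (s / k)) ^ b)"
    using s k by (intro nn_integral_gaussian_projection[OF on sp b]) auto
  also have "ennreal (1 / k ^ N) * ennreal (exp (- (s / k) * (\<Sum>j=b..<N. (cmod (cinner N (u j) p))\<^sup>2)) * (s / (s / k)) ^ b)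
      = ennreal (exp (- (s / k) * (\<Sum>j=b..<N. (cmod (cinner N (u j) p))\<^sup>2)) / k ^ (N - b))"
  proof -
    have "k ^ N = k ^ (N - b) * k ^ b" using b by (simp flip: power_add)
    then show ?thesis using s k by (simp flip: ennreal_mult)
  qed
  finally show ?thesis .
qed

section \<open>Pairwise comparison of least-squares residuals\<close>

text \<open>The infimum in \<open>residual\<close> runs over a countable dense set only to make it measurable; it is still
  the squared distance to the span, see \<open>residual_le\<close>.\<close>

definition rational_vectors :: "nat set \<Rightarrow> (nat \<Rightarrow> complex) set" where
  "rational_vectors J = (\<Pi>\<^sub>E j\<in>J. {z. Re z \<in> \<rat> \<and> Im z \<in> \<rat>})"

definition residual :: "nat \<Rightarrow> nat set \<Rightarrow> (nat \<times> nat \<Rightarrow> complex) \<Rightarrow> (nat \<Rightarrow> complex) \<Rightarrow> real" where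
  "residual N J A y = (INF z\<in>rational_vectors J. sqnorm N (\<lambda>i. y i - (\<Sum>j\<in>J. A (i, j) * z j)))"

lemma countable_rational_vectors: "finite J \<Longrightarrow> countable (rational_vectors J)"
proof -
  have "{z. Re z \<in> \<rat> \<and> Im z \<in> \<rat>} = (\<lambda>(a, b). Complex a b) ` (\<rat> \<times> \<rat>)"
    by (force simp: image_iff complex_eq_iff)
  then have "countable {z. Re z \<in> \<rat> \<and> Im z \<in> \<rat>}"
    by (simp add: countable_rat)
  then show "finite J \<Longrightarrow> ?thesis" unfolding rational_vectors_def by (intro countable_PiE) auto
qed

lemma complex_rational_approx: "0 < e \<Longrightarrow> \<exists>w. Re w \<in> \<rat> \<and> Im w \<in> \<rat> \<and> cmod (w - z) < e"
proof -
  assume e: "0 < e"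
  obtain a where a: "a \<in> \<rat>" "Re z < a" "a < Re z + e / 2"
    using Rats_dense_in_real[of "Re z" "Re z + e / 2"] e by auto
  obtain b where b: "b \<in> \<rat>" "Im z < b" "b < Im z + e / 2"
    using Rats_dense_in_real[of "Im z" "Im z + e / 2"] e by auto
  have "cmod (Complex a b - z) \<le> \<bar>Re (Complex a b - z)\<bar> + \<bar>Im (Complex a b - z)\<bar>"
    by (rule cmod_le)
  also have "\<dots> < e" using a b by simp
  finally show ?thesis using a b by (intro exI[of _ "Complex a b"]) simp
qed

text \<open>Rational coefficients converge to \<open>z\<close>, and the squared norm is continuous
  in the coefficients.\<close>

lemma residual_le: "residual N J A y \<le> sqnorm N (\<lambda>i. y i - (\<Sum>j\<in>J. A (i, j) * z j))"
proof -
  have "\<forall>m j. \<exists>w. Re w \<in> \<rat> \<and> Im w \<in> \<rat> \<and> cmod (w - z j) < 1 / real (Suc m)"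
    by (intro allI complex_rational_approx) simp
  then obtain w where w: "\<And>m j. Re (w m j) \<in> \<rat>" "\<And>m j. Im (w m j) \<in> \<rat>"
      "\<And>m j. cmod (w m j - z j) < 1 / real (Suc m)"
    by metis
  have lim: "(\<lambda>m. w m j) \<longlonglongrightarrow> z j" for j
  proof (rule LIM_zero_cancel, rule Lim_null_comparison)
    show "\<forall>\<^sub>F m in sequentially. cmod (w m j - z j) \<le> 1 / real (Suc m)"
      using w(3) by (simp add: less_imp_le)
    show "(\<lambda>m. 1 / real (Suc m)) \<longlonglongrightarrow> 0"
      using LIMSEQ_inverse_real_of_nat by (simp add: inverse_eq_divide)
  qed
  have le: "residual N J A y \<le> sqnorm N (\<lambda>i. y i - (\<Sum>j\<in>J. A (i, j) * w m j))" for m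
  proof -
    have "residual N J A y \<le> sqnorm N (\<lambda>i. y i - (\<Sum>j\<in>J. A (i, j) * restrict (w m) J j))"
      unfolding residual_def
      by (rule cINF_lower) (auto intro!: bdd_belowI[of _ 0] simp: rational_vectors_def w)
    then show ?thesis by simp
  qed
  have "(\<lambda>m. sqnorm N (\<lambda>i. y i - (\<Sum>j\<in>J. A (i, j) * w m j)))
      \<longlonglongrightarrow> sqnorm N (\<lambda>i. y i - (\<Sum>j\<in>J. A (i, j) * z j))"
    unfolding sqnorm_def by (intro tendsto_intros lim)
  then show ?thesis using le by (intro LIMSEQ_le_const) auto
qed

lemma residual_ge:
  assumes "\<And>z. c \<le> sqnorm N (\<lambda>i. y i - (\<Sum>j\<in>J. A (i, j) * z j))"
  shows "c \<le> residual N J A y"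
  unfolding residual_def
proof (rule cINF_greatest)
  have "restrict (\<lambda>_. 0) J \<in> rational_vectors J" by (simp add: rational_vectors_def)
  then show "rational_vectors J \<noteq> {}" by blast
qed (rule assms)

lemma residual_cong:
  "(\<And>i. i < N \<Longrightarrow> y i = y' i) \<Longrightarrow> residual N J A y = residual N J A y'"
  by (simp add: residual_def sqnorm_def)

lemma borel_measurable_residual [measurable (raw)]:
  assumes J: "J \<subseteq> {..<M}"
    and [measurable]: "f \<in> X \<rightarrow>\<^sub>M (\<Pi>\<^sub>M ij\<in>{..<N} \<times> {..<M}. borel)" "g \<in> X \<rightarrow>\<^sub>M (\<Pi>\<^sub>M i\<in>{..<N}. borel)"
  shows "(\<lambda>\<omega>. residual N J (f \<omega>) (g \<omega>)) \<in> borel_measurable X"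
proof -
  have fin: "finite J" using J finite_subset by blast
  have [measurable]: "(\<lambda>\<omega>. f \<omega> (i, j)) \<in> borel_measurable X" if "i \<in> {..<N}" "j \<in> J" for i j
    using that J by (intro measurable_component_singleton'[OF assms(2)] measurable_ident) auto
  show ?thesis
    unfolding residual_def sqnorm_def
    using countable_rational_vectors[OF fin] by measurable
qed

text \<open>The first \<open>a\<close> vectors of \<open>u\<close> are built to span the columns of
  \<open>I \<inter> J\<close>, the first \<open>b\<close> those of \<open>J\<close>. All is chosen
  from \<open>B\<close> before the remaining columns and the noise, hence constant in the later
  integrations. A fit with \<open>J\<close> cannot touch the coordinates from \<open>b\<close> on,
  which gives the first bound; a fit with \<open>I\<close> can match the signal exactly and also
  remove the noise inside the span of the common columns, which gives the second.\<close>

lemma residual_bounds: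
  fixes B :: "nat \<times> nat \<Rightarrow> complex" and x :: "nat \<Rightarrow> complex"
  assumes I: "finite I" and J: "finite J"
  obtains u a b where "orthonormal N N u" "\<forall>v. spanned N N u v" "a \<le> b" "b \<le> N" "b \<le> card J" "b \<le> a + card (J - I)"
    "\<forall>A n. (\<forall>i<N. \<forall>j\<in>J. A (i, j) = B (i, j)) \<longrightarrow>
       (\<Sum>j=b..<N. (cmod (cinner N (u j) (\<lambda>i. n i + (\<Sum>l\<in>I - J. x l * A (i, l)))))\<^sup>2)
          \<le> residual N J A (\<lambda>i. (\<Sum>j\<in>I. A (i, j) * x j) + n i) \<and>
       residual N I A (\<lambda>i. (\<Sum>j\<in>I. A (i, j) * x j) + n i) \<le> (\<Sum>j=a..<N. (cmod (cinner N (u j) n))\<^sup>2)"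
proof -
  let ?K = "I \<inter> J" and ?col = "\<lambda>k i. B (i, k)"
  \<comment> \<open>Membership in the span of the common columns. Carried through Gram-Schmidt, it
    keeps every \<open>u j\<close> with \<open>j < a\<close> expressible by these columns, as the
    explicit coefficients for \<open>residual_le\<close> require.\<close>
  let ?Q = "\<lambda>f. \<exists>z. \<forall>i<N. f i = (\<Sum>k\<in>?K. B (i, k) * z k)"
  have Q_add: "?Q (\<lambda>i. v i + c * w i)" if vw: "?Q v" "?Q w" for v w c
  proof -
    from vw obtain z z' where "\<forall>i<N. v i = (\<Sum>k\<in>?K. B (i, k) * z k)" "\<forall>i<N. w i = (\<Sum>k\<in>?K. B (i, k) * z' k)"
      by auto
    then show ?thesis
      by (intro exI[of _ "\<lambda>k. z k + c * z' k"]) (simp add: distrib_left sum.distrib sum_distrib_left mult.left_commute)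
  qed
  have Q_0: "?Q (\<lambda>_. 0)" by (intro exI[of _ "\<lambda>_. 0"]) simp
  have Q_col: "?Q (?col k)" if "k \<in> ?K" for k
    using that I by (intro exI[of _ "\<lambda>l. of_bool (l = k)"]) (simp add: of_bool_def if_distrib cong: if_cong)
  obtain a u0 where a: "a \<le> card ?K" and on0: "orthonormal N a u0"
    and sp0: "\<And>k. k \<in> ?K \<Longrightarrow> spanned N a u0 (?col k)" and Q0: "\<And>j. j < a \<Longrightarrow> ?Q (u0 j)"
    using gram_schmidt[where K = ?K and r = 0 and u = "\<lambda>_ _. 0" and N = N and Q = ?Q and f = ?col, OF _ _ Q_add Q_0 _ Q_col] I
    by (auto simp: orthonormal_def)
  obtain b u1 where b: "a \<le> b" "b \<le> a + card (J - I)" and u1: "\<And>j. j < a \<Longrightarrow> u1 j = u0 j" and on1: "orthonormal N b u1"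
    and sp1: "\<And>k. k \<in> J - I \<Longrightarrow> spanned N b u1 (?col k)"
    using gram_schmidt[of "J - I" N a u0 "\<lambda>_. True" ?col] J on0 by auto
  obtain u where bN: "b \<le> N" and u: "\<And>j. j < b \<Longrightarrow> u j = u1 j" and on: "orthonormal N N u" and sp: "\<And>v. spanned N N u v"
    using orthonormal_completion[OF on1] by auto
  have onb: "orthonormal N b u" using on bN by (rule orthonormal_mono)
  have col: "spanned N b u (?col k)" if "k \<in> J" for k
  proof (cases "k \<in> I")
    case True
    then have "spanned N a u (?col k)" using sp0[of k] that u u1 b by (simp add: spanned_def)
    then show ?thesis by (rule spanned_mono[OF onb]) (rule b)
  next
    case False
    then show ?thesis using sp1[of k] that u by (simp add: spanned_def)
  qed
  have cardJ: "card J = card ?K + card (J - I)"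
    using J by (metis Int_commute card_Diff_subset_Int card_mono finite_Int inf_le1 le_add_diff_inverse)
  have "\<exists>z. \<forall>j<a. \<forall>i<N. u j i = (\<Sum>k\<in>?K. B (i, k) * z j k)"
  proof -
    have "\<forall>j\<in>{..<a}. \<exists>z. \<forall>i<N. u j i = (\<Sum>k\<in>?K. B (i, k) * z k)"
      using Q0 u u1 b by auto
    then show ?thesis by (auto dest!: bchoice)
  qed
  then obtain zz where zz: "\<And>j i. j < a \<Longrightarrow> i < N \<Longrightarrow> u j i = (\<Sum>k\<in>?K. B (i, k) * zz j k)" by blast
  have "(\<Sum>j=b..<N. (cmod (cinner N (u j) (\<lambda>i. n i + (\<Sum>l\<in>I - J. x l * A (i, l)))))\<^sup>2)
          \<le> residual N J A (\<lambda>i. (\<Sum>j\<in>I. A (i, j) * x j) + n i)"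
    if A: "\<forall>i<N. \<forall>j\<in>J. A (i, j) = B (i, j)" for A n
  proof (rule residual_ge)
    fix z
    let ?g = "\<lambda>i. n i + (\<Sum>l\<in>I - J. x l * A (i, l))"
    let ?w = "\<lambda>i. \<Sum>j\<in>J. (z j - (if j \<in> I then x j else 0)) * B (i, j)"
    let ?v = "\<lambda>i. (\<Sum>j\<in>I. A (i, j) * x j) + n i - (\<Sum>j\<in>J. A (i, j) * z j)"
    have v: "?v i = ?g i - ?w i" if "i < N" for i
    proof -
      have "(\<Sum>j\<in>I. A (i, j) * x j) = (\<Sum>j\<in>I - J. A (i, j) * x j) + (\<Sum>j\<in>?K. A (i, j) * x j)"
        using I by (subst sum.Int_Diff[of _ _ J]) auto
      moreover have "(\<Sum>j\<in>?K. A (i, j) * x j) = (\<Sum>j\<in>J. (if j \<in> I then x j else 0) * B (i, j))"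
        using A that J by (intro sum.mono_neutral_cong_left) (auto simp: mult.commute)
      moreover have "(\<Sum>j\<in>J. A (i, j) * z j) = (\<Sum>j\<in>J. z j * B (i, j))"
        using A that by (intro sum.cong) auto
      ultimately show ?thesis by (simp add: left_diff_distrib right_diff_distrib sum_subtractf mult.commute)
    qed
    have w: "cinner N (u j) ?w = 0" if "b \<le> j" "j < N" for j
      by (rule cinner_spanned_0[OF on spanned_sum[OF col] that])
    have gv: "cinner N (u j) ?g = cinner N (u j) ?v" if "b \<le> j" "j < N" for j
    proof -
      have "cinner N (u j) ?v = cinner N (u j) (\<lambda>i. ?g i - ?w i)"
        by (rule cinner_cong) (simp_all only: v)
      then show ?thesis by (simp only: cinner_diff w[OF that] diff_0_right)
    qed
    have "(\<Sum>j=b..<N. (cmod (cinner N (u j) ?g))\<^sup>2) = (\<Sum>j=b..<N. (cmod (cinner N (u j) ?v))\<^sup>2)"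
      by (intro sum.cong refl) (simp only: gv atLeastLessThan_iff)
    also have "\<dots> \<le> (\<Sum>j<N. (cmod (cinner N (u j) ?v))\<^sup>2)"
      by (intro sum_mono2) auto
    also have "\<dots> = sqnorm N ?v"
      by (rule sqnorm_spanned[OF on sp, symmetric])
    finally show "(\<Sum>j=b..<N. (cmod (cinner N (u j) ?g))\<^sup>2) \<le> sqnorm N ?v" .
  qed
  moreover have "residual N I A (\<lambda>i. (\<Sum>j\<in>I. A (i, j) * x j) + n i) \<le> (\<Sum>j=a..<N. (cmod (cinner N (u j) n))\<^sup>2)"
    if A: "\<forall>i<N. \<forall>j\<in>J. A (i, j) = B (i, j)" for A n
  proof -
    \<comment> \<open>The true coefficients, corrected so as to subtract the projection of
      \<open>n\<close> onto the first \<open>a\<close> vectors. Within \<open>I\<close>, only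
      entries in \<open>I \<inter> J\<close> change.\<close>
    define z where "z = (\<lambda>k. x k + (if k \<in> J then \<Sum>j<a. cinner N (u j) n * zz j k else 0))"
    have eq: "(\<Sum>j\<in>I. A (i, j) * x j) + n i - (\<Sum>j\<in>I. A (i, j) * z j) = n i - (\<Sum>j<a. cinner N (u j) n * u j i)"
      if i: "i < N" for i
    proof -
      have "(\<Sum>k\<in>I. A (i, k) * z k) = (\<Sum>k\<in>I. A (i, k) * x k)
          + (\<Sum>k\<in>I. A (i, k) * (if k \<in> J then \<Sum>j<a. cinner N (u j) n * zz j k else 0))"
        by (simp add: z_def distrib_left sum.distrib)
      also have "(\<Sum>k\<in>I. A (i, k) * (if k \<in> J then \<Sum>j<a. cinner N (u j) n * zz j k else 0))
          = (\<Sum>k\<in>?K. B (i, k) * (\<Sum>j<a. cinner N (u j) n * zz j k))"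
        using A i I by (intro sum.mono_neutral_cong_right) auto
      also have "\<dots> = (\<Sum>j<a. cinner N (u j) n * (\<Sum>k\<in>?K. B (i, k) * zz j k))"
        unfolding sum_distrib_left by (subst sum.swap) (simp add: mult.left_commute)
      also have "\<dots> = (\<Sum>j<a. cinner N (u j) n * u j i)"
        using zz i by simp
      finally show ?thesis by simp
    qed
    have "sqnorm N (\<lambda>i. (\<Sum>j\<in>I. A (i, j) * x j) + n i - (\<Sum>j\<in>I. A (i, j) * z j))
        = sqnorm N (\<lambda>i. n i - (\<Sum>j<a. cinner N (u j) n * u j i))"
      unfolding sqnorm_def by (intro sum.cong refl) (simp only: eq lessThan_iff)
    also have "\<dots> = (\<Sum>j=a..<N. (cmod (cinner N (u j) n))\<^sup>2)"
      using b bN by (subst sqnorm_diff_orthonormal_sum[OF on sp]) auto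
    finally show ?thesis
      using residual_le[of N I A "\<lambda>i. (\<Sum>j\<in>I. A (i, j) * x j) + n i" z] by simp
  qed
  ultimately show ?thesis
    using that[of u a b] on sp b bN a cardJ by simp
qed

lemma nn_integral_pairwise_error:
  fixes B :: "nat \<times> nat \<Rightarrow> complex" and x :: "nat \<Rightarrow> complex"
  assumes I: "finite I" and J: "finite J" and \<nu>: "0 < \<nu>"
    and F: "\<And>\<omega> i j. i < N \<Longrightarrow> j \<in> J \<Longrightarrow> F \<omega> (i, j) = B (i, j)"
      "\<And>\<omega> i j. i < N \<Longrightarrow> j \<in> I - J \<Longrightarrow> F \<omega> (i, j) = \<omega> (i, j)"
  defines "y \<equiv> \<lambda>\<omega> n i. (\<Sum>j\<in>I. F \<omega> (i, j) * x j) + n i"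
  shows "(\<integral>\<^sup>+n. \<integral>\<^sup>+\<omega>. (if residual N J (F \<omega>) (y \<omega> n) \<le> residual N I (F \<omega>) (y \<omega> n) then 1 else 0)
            \<partial>(\<Pi>\<^sub>M e\<in>{..<N} \<times> (I - J). complex_gaussian 1) \<partial>gaussian_noise \<nu> N)
       \<le> ennreal (2 ^ card (J - I) / (1 + (\<Sum>j\<in>I - J. (cmod (x j))\<^sup>2) / (4 * \<nu>\<^sup>2)) ^ (N - card J))"
proof -
  let ?A = "\<Pi>\<^sub>M e\<in>{..<N} \<times> (I - J). complex_gaussian 1"
  let ?T = "\<Sum>j\<in>I - J. (cmod (x j))\<^sup>2"
  define s where "s = 1 / (2 * \<nu>\<^sup>2)"
  have s: "0 < s" using \<nu> by (simp add: s_def)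
  define k where "k = 1 + s * ?T"
  have k: "1 \<le> k" using s by (simp add: k_def sum_nonneg)
  obtain u a b where on: "orthonormal N N u" and sp': "\<forall>v. spanned N N u v"
    and ab: "a \<le> b" "b \<le> N" "b \<le> card J" "b \<le> a + card (J - I)"
    and res: "\<forall>A n. (\<forall>i<N. \<forall>j\<in>J. A (i, j) = B (i, j)) \<longrightarrow>
       (\<Sum>j=b..<N. (cmod (cinner N (u j) (\<lambda>i. n i + (\<Sum>l\<in>I - J. x l * A (i, l)))))\<^sup>2)
          \<le> residual N J A (\<lambda>i. (\<Sum>j\<in>I. A (i, j) * x j) + n i) \<and>
       residual N I A (\<lambda>i. (\<Sum>j\<in>I. A (i, j) * x j) + n i) \<le> (\<Sum>j=a..<N. (cmod (cinner N (u j) n))\<^sup>2)"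
    by (rule residual_bounds[OF I J, of N B x]) (rule that)
  have sp: "spanned N N u v" for v using sp' by blast
  let ?Da = "\<lambda>n. \<Sum>j=a..<N. (cmod (cinner N (u j) n))\<^sup>2"
  let ?Db = "\<lambda>n. \<Sum>j=b..<N. (cmod (cinner N (u j) n))\<^sup>2"
  let ?g = "\<lambda>\<omega> n i. n i + (\<Sum>l\<in>I - J. x l * \<omega> (i, l))"
  \<comment> \<open>The coefficient of \<open>|cinner N (u j) n|^2\<close> after averaging over the
    columns: zero in the common span, the full \<open>s\<close> between \<open>a\<close> and
    \<open>b\<close>, and from \<open>b\<close> on \<open>s\<close> reduced by the weight
    \<open>s / k\<close> which that averaging leaves.\<close>
  define c where "c = (\<lambda>j. if j < a then 0 else if j < b then s else s - s / k)"
  have sk: "s / k \<le> s" "0 < s / k" using s k by (auto simp: divide_le_eq)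
  have ca: "0 \<le> c j" "\<nu>\<^sup>2 * c j < 1" for j
  proof -
    show "0 \<le> c j" using s sk by (simp add: c_def)
    have "c j \<le> s" using s sk by (simp add: c_def)
    then have "\<nu>\<^sup>2 * c j \<le> \<nu>\<^sup>2 * s" using \<nu> by (intro mult_left_mono) auto
    also have "\<dots> < 1" using \<nu> by (simp add: s_def)
    finally show "\<nu>\<^sup>2 * c j < 1" .
  qed
  have cD: "s * ?Da n - s / k * ?Db n = (\<Sum>j<N. c j * (cmod (cinner N (u j) n))\<^sup>2)" for n
  proof -
    have "(\<Sum>j<N. c j * (cmod (cinner N (u j) n))\<^sup>2) = (\<Sum>j=a..<N. c j * (cmod (cinner N (u j) n))\<^sup>2)"
      by (intro sum.mono_neutral_right) (auto simp: c_def)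
    also have "\<dots> = (\<Sum>j=a..<N. s * (cmod (cinner N (u j) n))\<^sup>2
        - (if b \<le> j then s / k * (cmod (cinner N (u j) n))\<^sup>2 else 0))"
      by (intro sum.cong) (auto simp: c_def left_diff_distrib)
    also have "(\<Sum>j=a..<N. s * (cmod (cinner N (u j) n))\<^sup>2
        - (if b \<le> j then s / k * (cmod (cinner N (u j) n))\<^sup>2 else 0)) = s * ?Da n - s / k * ?Db n"
    proof -
      have "(\<Sum>j=a..<N. if b \<le> j then s / k * (cmod (cinner N (u j) n))\<^sup>2 else 0)
          = (\<Sum>j=b..<N. s / k * (cmod (cinner N (u j) n))\<^sup>2)"
        using ab by (intro sum.mono_neutral_cong_right) auto
      then show ?thesis by (simp add: sum_subtractf sum_distrib_left)
    qed
    finally show ?thesis by simp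
  qed
  have "(\<integral>\<^sup>+n. \<integral>\<^sup>+\<omega>. (if residual N J (F \<omega>) (y \<omega> n) \<le> residual N I (F \<omega>) (y \<omega> n) then 1 else 0) \<partial>?A \<partial>gaussian_noise \<nu> N)
      \<le> (\<integral>\<^sup>+n. \<integral>\<^sup>+\<omega>. ennreal (exp (s * ?Da n)) * ennreal (exp (- s * ?Db (?g \<omega> n))) \<partial>?A \<partial>gaussian_noise \<nu> N)"
  proof (intro nn_integral_mono)
    fix n :: "nat \<Rightarrow> complex" and \<omega> :: "nat \<times> nat \<Rightarrow> complex"
    have "cinner N (u j) (\<lambda>i. n i + (\<Sum>l\<in>I - J. x l * F \<omega> (i, l))) = cinner N (u j) (?g \<omega> n)" for j
      using F(2) by (intro cinner_cong) auto
    then have D: "?Db (?g \<omega> n) \<le> residual N J (F \<omega>) (y \<omega> n)" "residual N I (F \<omega>) (y \<omega> n) \<le> ?Da n"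
      using res[rule_format, of "F \<omega>" n] F(1) unfolding y_def by simp_all
    show "(if residual N J (F \<omega>) (y \<omega> n) \<le> residual N I (F \<omega>) (y \<omega> n) then 1 else 0)
        \<le> ennreal (exp (s * ?Da n)) * ennreal (exp (- s * ?Db (?g \<omega> n)))"
    proof (cases "residual N J (F \<omega>) (y \<omega> n) \<le> residual N I (F \<omega>) (y \<omega> n)")
      case True
      then have "0 \<le> s * (?Da n - ?Db (?g \<omega> n))" using D s by (intro mult_nonneg_nonneg) auto
      then have "1 \<le> exp (s * ?Da n) * exp (- s * ?Db (?g \<omega> n))"
        unfolding exp_add[symmetric] by (simp add: right_diff_distrib)
      then have "1 \<le> ennreal (exp (s * ?Da n) * exp (- s * ?Db (?g \<omega> n)))"
        by (simp only: ennreal_1[symmetric] ennreal_leI)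
      then show ?thesis using True by (simp only: if_True ennreal_mult exp_ge_zero)
    qed simp
  qed
  also have "\<dots> = (\<integral>\<^sup>+n. ennreal (1 / k ^ (N - b)) * ennreal (exp (\<Sum>j<N. c j * (cmod (cinner N (u j) n))\<^sup>2)) \<partial>gaussian_noise \<nu> N)"
  proof (intro nn_integral_cong)
    fix n :: "nat \<Rightarrow> complex"
    have "(\<integral>\<^sup>+\<omega>. ennreal (exp (s * ?Da n)) * ennreal (exp (- s * ?Db (?g \<omega> n))) \<partial>?A)
        = ennreal (exp (s * ?Da n)) * (\<integral>\<^sup>+\<omega>. ennreal (exp (- s * ?Db (?g \<omega> n))) \<partial>?A)"
      by (rule nn_integral_cmult) (unfold cinner_def, measurable)
    also have "(\<integral>\<^sup>+\<omega>. ennreal (exp (- s * ?Db (?g \<omega> n))) \<partial>?A) = ennreal (exp (- (s / k) * ?Db n) / k ^ (N - b))"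
      unfolding k_def using I by (intro nn_integral_gaussian_columns_projection[OF on sp ab(2) s]) auto
    also have "ennreal (exp (s * ?Da n)) * \<dots> = ennreal (1 / k ^ (N - b)) * ennreal (exp (s * ?Da n - s / k * ?Db n))"
      unfolding diff_conv_add_uminus exp_add using k by (simp flip: ennreal_mult)
    finally show "(\<integral>\<^sup>+\<omega>. ennreal (exp (s * ?Da n)) * ennreal (exp (- s * ?Db (?g \<omega> n))) \<partial>?A)
        = ennreal (1 / k ^ (N - b)) * ennreal (exp (\<Sum>j<N. c j * (cmod (cinner N (u j) n))\<^sup>2))"
      unfolding cD .
  qed
  also have "\<dots> = ennreal (1 / k ^ (N - b)) * (\<integral>\<^sup>+n. ennreal (exp (\<Sum>j<N. c j * (cmod (cinner N (u j) n))\<^sup>2)) \<partial>gaussian_noise \<nu> N)"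
    unfolding gaussian_noise_def by (rule nn_integral_cmult) (unfold cinner_def, measurable)
  also have "(\<integral>\<^sup>+n. ennreal (exp (\<Sum>j<N. c j * (cmod (cinner N (u j) n))\<^sup>2)) \<partial>gaussian_noise \<nu> N)
      = ennreal (\<Prod>j<N. 1 / (1 - \<nu>\<^sup>2 * c j))"
    unfolding gaussian_noise_def using \<nu> ca by (intro nn_integral_gaussian_exp_orthonormal[OF on]) auto
  \<comment> \<open>Each \<open>j\<close> between \<open>a\<close> and \<open>b\<close> gives 2
    because \<open>\<nu>^2 * s = 1/2\<close>. From \<open>b\<close> on,
    \<open>2 * k / (k + 1)\<close> will combine with \<open>1 / k\<close> to
    \<open>2 / (k + 1)\<close>, the reciprocal of \<open>1 + ?T / (4 * \<nu>^2)\<close>.\<close>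
  also have "(\<Prod>j<N. 1 / (1 - \<nu>\<^sup>2 * c j)) = 2 ^ (b - a) * (2 * k / (k + 1)) ^ (N - b)"
  proof -
    have "(\<Prod>j<N. 1 / (1 - \<nu>\<^sup>2 * c j)) = (\<Prod>j=a..<N. 1 / (1 - \<nu>\<^sup>2 * c j))"
      by (intro prod.mono_neutral_right) (auto simp: c_def)
    also have "\<dots> = (\<Prod>j=a..<b. 1 / (1 - \<nu>\<^sup>2 * c j)) * (\<Prod>j=b..<N. 1 / (1 - \<nu>\<^sup>2 * c j))"
      using ab by (simp add: prod.atLeastLessThan_concat)
    also have "(\<Prod>j=a..<b. 1 / (1 - \<nu>\<^sup>2 * c j)) = (\<Prod>j=a..<b. 2)"
      using \<nu> by (intro prod.cong) (auto simp: c_def s_def)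
    also have "(\<Prod>j=b..<N. 1 / (1 - \<nu>\<^sup>2 * c j)) = (\<Prod>j=b..<N. 2 * k / (k + 1))"
    proof (intro prod.cong refl)
      fix j assume "j \<in> {b..<N}"
      then have "\<nu>\<^sup>2 * c j = \<nu>\<^sup>2 * s * (1 - 1 / k)" using ab by (simp add: c_def right_diff_distrib)
      also have "\<nu>\<^sup>2 * s = 1 / 2" using \<nu> by (simp add: s_def)
      finally have "1 - \<nu>\<^sup>2 * c j = (k + 1) / (2 * k)" using k by (simp add: field_simps)
      then show "1 / (1 - \<nu>\<^sup>2 * c j) = 2 * k / (k + 1)" by simp
    qed
    finally show ?thesis by simp
  qed
  also have "ennreal (1 / k ^ (N - b)) * ennreal (2 ^ (b - a) * (2 * k / (k + 1)) ^ (N - b))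
      = ennreal (2 ^ (b - a) / (1 + ?T / (4 * \<nu>\<^sup>2)) ^ (N - b))"
  proof -
    have "1 + ?T / (4 * \<nu>\<^sup>2) = (k + 1) / 2" using \<nu> by (simp add: k_def s_def field_simps)
    then show ?thesis using k by (simp only: power_divide power_mult_distrib flip: ennreal_mult) (simp flip: ennreal_mult)
  qed
  \<comment> \<open>Here the dependence on \<open>a\<close> and \<open>b\<close>, and with it on
    \<open>B\<close>, disappears.\<close>
  also have "\<dots> \<le> ennreal (2 ^ card (J - I) / (1 + ?T / (4 * \<nu>\<^sup>2)) ^ (N - card J))"
    using ab by (intro ennreal_leI frac_le power_increasing) (auto simp: sum_nonneg intro!: zero_less_power add_pos_nonneg)
  finally show ?thesis .
qed

section \<open>The least-squares decoder\<close>

definition candidates :: "nat \<Rightarrow> nat \<Rightarrow> nat set set" where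
  "candidates M L = {J. J \<subseteq> {..<M} \<and> card J = L}"

text \<open>Coding finite sets as numbers turns the tie-breaking among minimisers into a measurable
  \<open>LEAST\<close>.\<close>

definition least_squares_decoder ::
    "nat \<Rightarrow> nat \<Rightarrow> nat \<Rightarrow> (nat \<times> nat \<Rightarrow> complex) \<Rightarrow> (nat \<Rightarrow> complex) \<Rightarrow> nat set" where
  "least_squares_decoder N M L A y = set_decode (LEAST k. set_decode k \<in> candidates M L \<and>
     (\<forall>J\<in>candidates M L. residual N (set_decode k) A y \<le> residual N J A y))"

lemma finite_candidates: "finite (candidates M L)"
  by (rule finite_subset[of _ "Pow {..<M}"]) (auto simp: candidates_def)

lemma least_squares_decoder:
  assumes "L \<le> M"
  shows "least_squares_decoder N M L A y \<in> candidates M L"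
    and "J \<in> candidates M L \<Longrightarrow> residual N (least_squares_decoder N M L A y) A y \<le> residual N J A y"
proof -
  have "{..<L} \<in> candidates M L" using assms by (auto simp: candidates_def)
  then have ne: "candidates M L \<noteq> {}" by blast
  define J0 where "J0 = arg_min_on (\<lambda>J. residual N J A y) (candidates M L)"
  have J0: "J0 \<in> candidates M L" "\<forall>J\<in>candidates M L. residual N J0 A y \<le> residual N J A y"
    using arg_min_if_finite[OF finite_candidates ne, of "\<lambda>J. residual N J A y"]
    by (auto simp: J0_def not_less)
  have "finite J0" using J0(1) finite_subset by (auto simp: candidates_def)
  then have "set_decode (set_encode J0) = J0" by simp
  with J0 have "set_decode (set_encode J0) \<in> candidates M L \<and>
     (\<forall>J\<in>candidates M L. residual N (set_decode (set_encode J0)) A y \<le> residual N J A y)" by simp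
  from LeastI[of "\<lambda>k. set_decode k \<in> candidates M L \<and>
     (\<forall>J\<in>candidates M L. residual N (set_decode k) A y \<le> residual N J A y)", OF this]
  show "least_squares_decoder N M L A y \<in> candidates M L"
    and "J \<in> candidates M L \<Longrightarrow> residual N (least_squares_decoder N M L A y) A y \<le> residual N J A y"
    by (auto simp: least_squares_decoder_def)
qed

lemma measurable_least_squares_decoder:
  assumes "L \<le> M"
  shows "(\<lambda>(A, y). least_squares_decoder N M L A y) \<in>
    (\<Pi>\<^sub>M ij\<in>{..<N} \<times> {..<M}. borel) \<Otimes>\<^sub>M (\<Pi>\<^sub>M i\<in>{..<N}. borel) \<rightarrow>\<^sub>M count_space (candidates M L)"
    (is "_ \<in> ?X \<rightarrow>\<^sub>M _")
proof -
  have [measurable]: "(\<lambda>p. residual N J (fst p) (snd p)) \<in> borel_measurable ?X" if "J \<in> candidates M L" for J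
    using that by (intro borel_measurable_residual[of J M]) (auto simp: candidates_def)
  have "Measurable.pred ?X (\<lambda>p. set_decode k \<in> candidates M L \<and>
     (\<forall>J\<in>candidates M L. residual N (set_decode k) (fst p) (snd p) \<le> residual N J (fst p) (snd p)))" for k
    using finite_candidates[of M L] by (cases "set_decode k \<in> candidates M L") (simp_all, measurable)
  then have "(\<lambda>p. set_decode (LEAST k. set_decode k \<in> candidates M L \<and>
     (\<forall>J\<in>candidates M L. residual N (set_decode k) (fst p) (snd p) \<le> residual N J (fst p) (snd p))))
     \<in> ?X \<rightarrow>\<^sub>M count_space UNIV"
    by measurable
  then have "(\<lambda>(A, y). least_squares_decoder N M L A y) \<in> ?X \<rightarrow>\<^sub>M restrict_space (count_space UNIV) (candidates M L)"
    using least_squares_decoder(1)[OF assms]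
    by (intro measurable_restrict_space2) (auto simp: least_squares_decoder_def case_prod_unfold)
  then show ?thesis by (simp add: restrict_count_space)
qed

text \<open>A union bound over the wrong candidates \<open>J\<close>. For each one the matrix splits
  into the columns of \<open>supp M x - J\<close> and the rest; the pairwise bound is uniform in the
  rest, so integrating over it costs nothing.\<close>

lemma p_err_le:
  assumes \<nu>: "0 < \<nu>" and L: "card (supp M x) = L"
  shows "p_err \<nu> N M (least_squares_decoder N M L) x
    \<le> (\<Sum>J\<in>candidates M L - {supp M x}.
        2 ^ card (J - supp M x) / (1 + (\<Sum>j\<in>supp M x - J. (cmod (x j))\<^sup>2) / (4 * \<nu>\<^sup>2)) ^ (N - L))"
proof -
  let ?I = "supp M x" and ?C = "candidates M L - {supp M x}"
  let ?P = "gaussian_noise \<nu> N" and ?G = "gaussian_matrix N M"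
  let ?bd = "\<lambda>J. 2 ^ card (J - ?I) / (1 + (\<Sum>j\<in>?I - J. (cmod (x j))\<^sup>2) / (4 * \<nu>\<^sup>2)) ^ (N - L)"
  define y where "y = (\<lambda>A n (i :: nat). (\<Sum>j\<in>?I. A (i, j) * x j) + n i :: complex)"
  have IM: "?I \<subseteq> {..<M}" by (auto simp: supp_def)
  then have finI: "finite ?I" using finite_subset by blast
  have "L \<le> M" using card_mono[OF _ IM] L by simp
  note dec = least_squares_decoder[OF this]
  have Ic: "?I \<in> candidates M L" using IM L by (simp add: candidates_def)
  have setsP [measurable_cong]: "sets ?P = sets (\<Pi>\<^sub>M i\<in>{..<N}. borel)"
    unfolding gaussian_noise_def by (rule sets_PiM_complex_gaussian)
  have setsG [measurable_cong]: "sets ?G = sets (\<Pi>\<^sub>M ij\<in>{..<N} \<times> {..<M}. borel)"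
    unfolding gaussian_matrix_def by (rule sets_PiM_complex_gaussian)
  interpret P: prob_space ?P
    unfolding gaussian_noise_def using \<nu> by (intro prob_space_PiM prob_space_complex_gaussian) simp
  interpret psf: product_sigma_finite "\<lambda>_ :: nat \<times> nat. complex_gaussian 1"
    by (rule product_sigma_finite_complex_gaussian) simp
  have obs: "residual N J A (observe N M A x n) = residual N J A (y A n)" for J A n
  proof (rule residual_cong)
    fix i assume "i < N"
    moreover have "(\<Sum>j<M. A (i, j) * x j) = (\<Sum>j\<in>?I. A (i, j) * x j)"
      using IM by (intro sum.mono_neutral_right) (auto simp: supp_def)
    ultimately show "observe N M A x n i = y A n i" by (simp add: observe_def y_def)
  qed
  have res [measurable]: "(\<lambda>p. residual N J (fst p) (y (fst p) (snd p))) \<in> borel_measurable (?G \<Otimes>\<^sub>M ?P)"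
    if "J \<in> candidates M L" for J
  proof -
    \<comment> \<open>\<open>y\<close> is not extensional and becomes a map into the product space
      only after restriction; \<open>residual\<close> looks at indices below \<open>N\<close> only
      and does not notice.\<close>
    have "(\<lambda>p. residual N J (fst p) (\<lambda>i\<in>{..<N}. y (fst p) (snd p) i)) \<in> borel_measurable (?G \<Otimes>\<^sub>M ?P)"
    proof (rule borel_measurable_residual[of J M])
      show "J \<subseteq> {..<M}" using that by (simp add: candidates_def)
      show "fst \<in> ?G \<Otimes>\<^sub>M ?P \<rightarrow>\<^sub>M (\<Pi>\<^sub>M ij\<in>{..<N} \<times> {..<M}. borel)" by measurable
      have [measurable]: "(\<lambda>p. fst p (i, j)) \<in> borel_measurable (?G \<Otimes>\<^sub>M ?P)" if "i < N" "j \<in> ?I" for i j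
        using that IM by (intro measurable_component_singleton'[where g = fst and f = "\<lambda>x. x" and I = "{..<N} \<times> {..<M}" and M = "\<lambda>_. borel"]) (auto intro: measurable_ident_sets[OF setsG])
      show "(\<lambda>p. \<lambda>i\<in>{..<N}. y (fst p) (snd p) i) \<in> ?G \<Otimes>\<^sub>M ?P \<rightarrow>\<^sub>M (\<Pi>\<^sub>M i\<in>{..<N}. borel)"
        unfolding y_def by (rule measurable_restrict) measurable
    qed
    also have "(\<lambda>p. residual N J (fst p) (\<lambda>i\<in>{..<N}. y (fst p) (snd p) i))
        = (\<lambda>p. residual N J (fst p) (y (fst p) (snd p)))"
      by (intro ext residual_cong) simp
    finally show ?thesis .
  qed
  let ?f = "\<lambda>J A n. (if residual N J A (y A n) \<le> residual N ?I A (y A n) then 1 else 0 :: ennreal)"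
  have f [measurable]: "(\<lambda>p. ?f J (fst p) (snd p)) \<in> borel_measurable (?G \<Otimes>\<^sub>M ?P)"
    if "J \<in> candidates M L" for J
    using res[OF that] res[OF Ic] by measurable
  have fG: "(\<lambda>A. \<integral>\<^sup>+n. ?f J A n \<partial>?P) \<in> borel_measurable ?G" if "J \<in> candidates M L" for J
    using f[OF that] by (intro P.borel_measurable_nn_integral) (simp add: case_prod_unfold)
  have "ennreal (p_err_given \<nu> N M (least_squares_decoder N M L) x A) \<le> (\<Sum>J\<in>?C. \<integral>\<^sup>+n. ?f J A n \<partial>?P)"
    if A: "A \<in> space ?G" for A
  proof -
    let ?E = "\<lambda>J. {n \<in> space ?P. residual N J A (y A n) \<le> residual N ?I A (y A n)}"
    have meas: "(\<lambda>n. residual N J A (y A n)) \<in> borel_measurable ?P" if "J \<in> candidates M L" for J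
      using measurable_compose_Pair1[OF A res[OF that]] by simp
    have E: "?E J \<in> sets ?P" if "J \<in> ?C" for J
    proof -
      have Jc: "J \<in> candidates M L" using that by simp
      show ?thesis by (intro borel_measurable_le meas[OF Jc] meas[OF Ic])
    qed
    \<comment> \<open>A wrong output is itself a candidate that fits no worse than the true support;
      ties are counted as errors.\<close>
    have "{n \<in> space ?P. least_squares_decoder N M L A (observe N M A x n) \<noteq> ?I} \<subseteq> (\<Union>J\<in>?C. ?E J)"
    proof
      fix n assume n: "n \<in> {n \<in> space ?P. least_squares_decoder N M L A (observe N M A x n) \<noteq> ?I}"
      let ?d = "least_squares_decoder N M L A (observe N M A x n)"
      have "n \<in> ?E ?d"
        using n dec(2)[OF Ic, of N A "observe N M A x n"] by (simp add: obs)
      moreover have "?d \<in> ?C" using n dec(1) by simp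
      ultimately show "n \<in> (\<Union>J\<in>?C. ?E J)" by blast
    qed
    then have "ennreal (p_err_given \<nu> N M (least_squares_decoder N M L) x A) \<le> emeasure ?P (\<Union>J\<in>?C. ?E J)"
      unfolding p_err_given_def P.emeasure_eq_measure[symmetric]
      using E finite_candidates by (intro emeasure_mono sets.finite_UN) auto
    also have "\<dots> \<le> (\<Sum>J\<in>?C. emeasure ?P (?E J))"
      using E finite_candidates by (intro emeasure_subadditive_finite) auto
    also have "\<dots> = (\<Sum>J\<in>?C. \<integral>\<^sup>+n. ?f J A n \<partial>?P)"
    proof (intro sum.cong refl)
      fix J assume "J \<in> ?C"
      then have "?E J \<in> sets ?P" by (rule E)
      then have "emeasure ?P (?E J) = (\<integral>\<^sup>+n. indicator (?E J) n \<partial>?P)" by simp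
      also have "\<dots> = (\<integral>\<^sup>+n. ?f J A n \<partial>?P)"
        by (intro nn_integral_cong) (auto simp: indicator_def)
      finally show "emeasure ?P (?E J) = (\<integral>\<^sup>+n. ?f J A n \<partial>?P)" .
    qed
    finally show ?thesis .
  qed
  then have "(\<integral>\<^sup>+A. ennreal (p_err_given \<nu> N M (least_squares_decoder N M L) x A) \<partial>?G)
      \<le> (\<integral>\<^sup>+A. (\<Sum>J\<in>?C. \<integral>\<^sup>+n. ?f J A n \<partial>?P) \<partial>?G)"
    by (rule nn_integral_mono)
  also have "\<dots> = (\<Sum>J\<in>?C. \<integral>\<^sup>+A. \<integral>\<^sup>+n. ?f J A n \<partial>?P \<partial>?G)"
    using fG by (intro nn_integral_sum) auto
  also have "\<dots> \<le> (\<Sum>J\<in>?C. ennreal (?bd J))"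
  proof (intro sum_mono)
    fix J assume "J \<in> ?C"
    then have Jc: "J \<in> candidates M L" by simp
    then have JM: "J \<subseteq> {..<M}" and cJ: "card J = L" by (auto simp: candidates_def)
    then have finJ: "finite J" using finite_subset by blast
    let ?E2 = "{..<N} \<times> (?I - J)" and ?E1 = "{..<N} \<times> ({..<M} - (?I - J))"
    let ?P1 = "\<Pi>\<^sub>M e\<in>?E1. complex_gaussian 1" and ?P2 = "\<Pi>\<^sub>M e\<in>?E2. complex_gaussian 1"
    have E: "?E1 \<union> ?E2 = {..<N} \<times> {..<M}" "?E1 \<inter> ?E2 = {}" using IM by auto
    interpret P1: prob_space ?P1 by (intro prob_space_PiM prob_space_complex_gaussian) simp
    interpret P2: prob_space ?P2 by (intro prob_space_PiM prob_space_complex_gaussian) simp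
    interpret PP: pair_sigma_finite ?P2 ?P ..
    have mrg: "merge ?E1 ?E2 \<in> ?P1 \<Otimes>\<^sub>M ?P2 \<rightarrow>\<^sub>M ?G"
      unfolding gaussian_matrix_def using measurable_merge[of ?E1 ?E2 "\<lambda>_. complex_gaussian 1"] E(1) by simp
    have "(\<integral>\<^sup>+A. \<integral>\<^sup>+n. ?f J A n \<partial>?P \<partial>?G)
        = (\<integral>\<^sup>+B. \<integral>\<^sup>+\<omega>. \<integral>\<^sup>+n. ?f J (merge ?E1 ?E2 (B, \<omega>)) n \<partial>?P \<partial>?P2 \<partial>?P1)"
      using psf.product_nn_integral_fold[OF E(2), unfolded E(1), of "\<lambda>A. \<integral>\<^sup>+n. ?f J A n \<partial>?P"] fG[OF Jc] finI
      unfolding gaussian_matrix_def by simp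
    also have "\<dots> \<le> (\<integral>\<^sup>+B. ennreal (?bd J) \<partial>?P1)"
    proof (intro nn_integral_mono)
      fix B assume B: "B \<in> space ?P1"
      have m1: "(\<lambda>p. (merge ?E1 ?E2 (B, fst p), snd p)) \<in> ?P2 \<Otimes>\<^sub>M ?P \<rightarrow>\<^sub>M ?G \<Otimes>\<^sub>M ?P"
        using measurable_compose[OF measurable_Pair1'[OF B] mrg] by measurable
      have "(\<lambda>p. ?f J (merge ?E1 ?E2 (B, fst p)) (snd p)) \<in> borel_measurable (?P2 \<Otimes>\<^sub>M ?P)"
        using measurable_compose[OF m1 f[OF Jc]] by simp
      then have "(\<integral>\<^sup>+\<omega>. \<integral>\<^sup>+n. ?f J (merge ?E1 ?E2 (B, \<omega>)) n \<partial>?P \<partial>?P2)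
          = (\<integral>\<^sup>+n. \<integral>\<^sup>+\<omega>. ?f J (merge ?E1 ?E2 (B, \<omega>)) n \<partial>?P2 \<partial>?P)"
        by (intro PP.Fubini'[symmetric]) (simp add: case_prod_unfold)
      also have "\<dots> \<le> ennreal (?bd J)"
        unfolding y_def cJ[symmetric]
        by (rule nn_integral_pairwise_error[OF finI finJ \<nu>, where B = B]) (use JM in \<open>auto simp: merge_def\<close>)
      finally show "(\<integral>\<^sup>+\<omega>. \<integral>\<^sup>+n. ?f J (merge ?E1 ?E2 (B, \<omega>)) n \<partial>?P \<partial>?P2) \<le> ennreal (?bd J)" .
    qed
    also have "\<dots> = ennreal (?bd J)" by (simp add: P1.emeasure_space_1)
    finally show "(\<integral>\<^sup>+A. \<integral>\<^sup>+n. ?f J A n \<partial>?P \<partial>?G) \<le> ennreal (?bd J)" .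
  qed
  also have "\<dots> = ennreal (\<Sum>J\<in>?C. ?bd J)"
    by (intro sum_ennreal divide_nonneg_nonneg zero_le_power add_nonneg_nonneg sum_nonneg) auto
  finally show ?thesis
    unfolding p_err_def
    by (intro integral_real_bounded sum_nonneg divide_nonneg_nonneg zero_le_power add_nonneg_nonneg) auto
qed

section \<open>Asymptotics\<close>

text \<open>Concavity: \<open>1 + k * \<theta>\<close> is the convex combination of \<open>1\<close>
  and \<open>1 + L * \<theta>\<close> with weight \<open>k / L\<close>. A single lower bound at
  \<open>k = L\<close> thus serves all \<open>k\<close>, with an exponent proportional to
  \<open>k\<close>.\<close>

lemma ln_one_plus_mult_ge:
  fixes \<theta> k L :: real
  assumes "0 \<le> \<theta>" "0 \<le> k" "k \<le> L" "0 < L"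
  shows "k / L * ln (1 + L * \<theta>) \<le> ln (1 + k * \<theta>)"
proof -
  have pos: "0 < 1 + L * \<theta>" using assms by (intro add_pos_nonneg) auto
  have "(1 - k / L) * ln 1 + k / L * ln (1 + L * \<theta>) \<le> ln ((1 - k / L) *\<^sub>R 1 + (k / L) *\<^sub>R (1 + L * \<theta>))"
    using assms pos by (intro concave_onD[OF ln_concave]) auto
  also have "(1 - k / L) *\<^sub>R 1 + (k / L) *\<^sub>R (1 + L * \<theta>) = 1 + k * \<theta>"
    using assms by (simp add: field_simps)
  finally show ?thesis by simp
qed

text \<open>Expand the product of \<open>card A\<close> factors \<open>r + 1\<close>; a subset
  records where \<open>r\<close> is chosen.\<close>

lemma sum_Pow_power_card: "finite A \<Longrightarrow> (\<Sum>D\<in>Pow A. r ^ card D) = (1 + r :: real) ^ card A"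
  using prod_add[of A "\<lambda>_. r" "\<lambda>_. 1"] by (simp add: add.commute)

text \<open>The bound depends on \<open>M\<close> alone, hence is uniform over all vectors that meet
  the conditions. A constant \<open>c\<close> in place of 6 would give
  \<open>r = 2 / t powr (c / 2)\<close>, so any \<open>c > 2\<close> makes \<open>M * r\<close>
  vanish; 6 makes it of order \<open>1 / M^2\<close>.\<close>

lemma p_err_le_exp:
  assumes \<nu>: "0 < \<nu>" and L: "card (supp M x) = L" and L0: "0 < L" and LM: "2 * L \<le> M"
    and ln1: "1 \<le> ln (real M - real L)" and N: "2 * real L * ln (real M - real L) \<le> real N"
    and \<mu>: "6 \<le> ln (1 + real L * ((min_mag M x)\<^sup>2 / (4 * \<nu>\<^sup>2)))"
  shows "p_err \<nu> N M (least_squares_decoder N M L) x \<le> exp (16 / (real M)\<^sup>2) - 1"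
proof -
  let ?I = "supp M x"
  define \<theta> where "\<theta> = (min_mag M x)\<^sup>2 / (4 * \<nu>\<^sup>2)"
  define t where "t = real M - real L"
  define r where "r = 2 / t ^ 3"
  have \<theta>: "0 \<le> \<theta>" by (simp add: \<theta>_def)
  have M0: "0 < M" using L0 LM by simp
  have t: "0 < t" "real M / 2 \<le> t" using L0 LM by (auto simp: t_def)
  have r0: "0 < r" using t by (simp add: r_def)
  have finI: "finite ?I" by (simp add: supp_def)
  have IM: "?I \<subseteq> {..<M}" by (auto simp: supp_def)
  have LN: "real L * ln t \<le> real (N - L)"
  proof -
    \<comment> \<open>One of the two copies of \<open>L * ln t\<close> below \<open>N\<close> pays
      for the \<open>L\<close> lost in \<open>N - L\<close>, since
      \<open>ln t \<ge> 1\<close>.\<close>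
    have "real L * 1 \<le> real L * ln t" using ln1 by (intro mult_left_mono) (auto simp: t_def)
    then have "real L + real L * ln t \<le> real N" using N by (simp add: t_def)
    then show ?thesis by linarith
  qed
  have mm: "min_mag M x \<le> cmod (x j)" if "j \<in> ?I" for j
    unfolding min_mag_def using that finI by (intro Min_le) auto
  have mm0: "0 \<le> min_mag M x"
  proof -
    have "?I \<noteq> {}" using L L0 by auto
    then show ?thesis unfolding min_mag_def using finI by (subst Min_ge_iff) auto
  qed
  let ?\<Delta> = "\<lambda>J. (?I - J) \<union> (J - ?I)"
  have term_le: "2 ^ card (J - ?I) / (1 + (\<Sum>j\<in>?I - J. (cmod (x j))\<^sup>2) / (4 * \<nu>\<^sup>2)) ^ (N - L) \<le> r ^ card (?\<Delta> J)"
    if "J \<in> candidates M L" for J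
  proof -
    have finJ: "finite J" and cJ: "card J = L" using that finite_subset by (auto simp: candidates_def)
    define k where "k = card (?I - J)"
    have k': "card (J - ?I) = k"
      using card_le_sym_Diff[OF finI finJ] card_le_sym_Diff[OF finJ finI] L cJ by (simp add: k_def)
    have kL: "k \<le> L" unfolding k_def L[symmetric] using finI by (intro card_mono) auto
    have card\<Delta>: "card (?\<Delta> J) = k + k"
      using finI finJ k' by (subst card_Un_disjoint) (auto simp: k_def)
    have "real k * (min_mag M x)\<^sup>2 \<le> (\<Sum>j\<in>?I - J. (cmod (x j))\<^sup>2)"
      unfolding k_def using mm mm0 by (intro sum_bounded_below power_mono) auto
    then have "1 + real k * \<theta> \<le> 1 + (\<Sum>j\<in>?I - J. (cmod (x j))\<^sup>2) / (4 * \<nu>\<^sup>2)"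
      unfolding \<theta>_def by (simp add: divide_right_mono)
    then have le1: "(1 + real k * \<theta>) ^ (N - L) \<le> (1 + (\<Sum>j\<in>?I - J. (cmod (x j))\<^sup>2) / (4 * \<nu>\<^sup>2)) ^ (N - L)"
      using \<theta> by (intro power_mono) auto
    have pos: "0 < 1 + real k * \<theta>" using \<theta> by (intro add_pos_nonneg) auto
    have le2: "t ^ (6 * k) \<le> (1 + real k * \<theta>) ^ (N - L)"
    proof -
      have "real k / real L * 6 \<le> real k / real L * ln (1 + real L * \<theta>)"
        using \<mu> by (intro mult_left_mono) (auto simp: \<theta>_def)
      also have "\<dots> \<le> ln (1 + real k * \<theta>)"
        using \<theta> kL L0 by (intro ln_one_plus_mult_ge) auto
      finally have a: "real k / real L * 6 \<le> ln (1 + real k * \<theta>)" .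
      have "real (6 * k) * ln t = (real L * ln t) * (real k / real L * 6)"
        using L0 by simp
      also have "\<dots> \<le> real (N - L) * ln (1 + real k * \<theta>)"
        using LN a ln1 by (intro mult_mono) (auto simp: t_def)
      finally have "exp (real (6 * k) * ln t) \<le> exp (real (N - L) * ln (1 + real k * \<theta>))" by simp
      then show ?thesis unfolding exp_of_nat_mult using t pos by simp
    qed
    have "2 ^ card (J - ?I) / (1 + (\<Sum>j\<in>?I - J. (cmod (x j))\<^sup>2) / (4 * \<nu>\<^sup>2)) ^ (N - L) \<le> 2 ^ k / t ^ (6 * k)"
      unfolding k' using t by (intro frac_le order_trans[OF le2 le1]) auto
    \<comment> \<open>Relaxing \<open>2 ^ k\<close> to \<open>4 ^ k\<close> gives
      \<open>r ^ (2 * k)\<close>, matching the \<open>2 * k\<close> elements of the symmetric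
      difference.\<close>
    also have "\<dots> \<le> 4 ^ k / t ^ (6 * k)"
      using t by (intro divide_right_mono power_mono) auto
    also have "\<dots> = (4 / t ^ 6) ^ k"
      by (simp add: power_divide power_mult)
    also have "(4 / t ^ 6) ^ k = (r ^ 2) ^ k"
      by (simp add: r_def power_divide power_mult[symmetric])
    also have "\<dots> = r ^ card (?\<Delta> J)"
      unfolding card\<Delta> by (simp add: power_mult[symmetric] mult_2)
    finally show ?thesis .
  qed
  have "p_err \<nu> N M (least_squares_decoder N M L) x \<le> (\<Sum>J\<in>candidates M L - {?I}. r ^ card (?\<Delta> J))"
    using term_le by (intro order_trans[OF p_err_le[OF \<nu> L, of N]] sum_mono) auto
  \<comment> \<open>\<open>J\<close> is recovered from its symmetric difference with the fixed
    support, so the reindexing is injective. Enlarging the range to all nonempty index sets then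
    spares any count of the \<open>J\<close> at a given distance.\<close>
  also have "\<dots> = (\<Sum>D\<in>?\<Delta> ` (candidates M L - {?I}). r ^ card D)"
    by (subst sum.reindex) (auto simp: inj_on_def)
  also have "\<dots> \<le> (\<Sum>D\<in>Pow {..<M} - {{}}. r ^ card D)"
    using r0 IM by (intro sum_mono2) (auto simp: candidates_def)
  also have "\<dots> = (1 + r) ^ M - 1"
    using sum_Pow_power_card[of "{..<M}" r] by (subst sum_diff) auto
  also have "\<dots> \<le> exp (r * real M) - 1"
  proof -
    have "(1 + r) ^ M \<le> exp r ^ M" using r0 exp_ge_add_one_self[of r] by (intro power_mono) auto
    then show ?thesis by (simp add: exp_of_nat_mult[symmetric] mult.commute)
  qed
  also have "r * real M \<le> 16 / (real M)\<^sup>2"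
  proof -
    have "r \<le> 2 / (real M / 2) ^ 3"
      unfolding r_def using t M0 by (intro divide_left_mono power_mono mult_pos_pos zero_less_power) auto
    then have "r * real M \<le> 2 / (real M / 2) ^ 3 * real M" by (intro mult_right_mono) auto
    also have "\<dots> = 16 / (real M)\<^sup>2" using M0 by (simp add: field_simps power2_eq_square power3_eq_cube)
    finally show ?thesis .
  qed
  finally show ?thesis by simp
qed

text \<open>The decoder is built from \<open>N M\<close>, \<open>M\<close> and \<open>L M\<close>
  alone, and the conditions of \<open>p_err_le_exp\<close> see the vector only through its sparsity
  and minimal magnitude, so the same bound holds for every admissible \<open>x'\<close>. What
  remains is that these conditions hold for all large \<open>M\<close>.\<close>

theorem theoremV1:
  "\<exists>C :: (nat \<Rightarrow> real) \<Rightarrow> real \<Rightarrow> real.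
     (\<forall>m \<nu>. 0 < C m \<nu>) \<and>
     (\<forall>(\<nu> :: real) (x :: nat \<Rightarrow> nat \<Rightarrow> complex) (L :: nat \<Rightarrow> nat) (N :: nat \<Rightarrow> nat).
        0 < \<nu> \<longrightarrow>
        (\<forall>M. l0 M (x M) = L M) \<longrightarrow>
        (\<lambda>M. real (L M)) \<in> o(\<lambda>M. real M) \<longrightarrow>
        filterlim L at_top sequentially \<longrightarrow>
        filterlim (\<lambda>M. real (L M) * min_mag M (x M) ^ 4) at_top sequentially \<longrightarrow>
        (\<lambda>M. real (N M)) \<succ>\<^sub>a
          (\<lambda>M. C (\<lambda>M. min_mag M (x M)) \<nu> * real (L M) * ln (real M - real (L M))) \<longrightarrow>
        reliable_recovery_possible \<nu> N x)"
proof (intro exI[of _ "\<lambda>_ _. 2"] conjI allI impI)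
  fix \<nu> :: real and x :: "nat \<Rightarrow> nat \<Rightarrow> complex" and L N :: "nat \<Rightarrow> nat"
  assume \<nu>: "0 < \<nu>" and L: "\<forall>M. l0 M (x M) = L M" and o: "(\<lambda>M. real (L M)) \<in> o(\<lambda>M. real M)"
    and Linf: "filterlim L at_top sequentially"
    and \<mu>: "filterlim (\<lambda>M. real (L M) * min_mag M (x M) ^ 4) at_top sequentially"
    and succ: "(\<lambda>M. real (N M)) \<succ>\<^sub>a (\<lambda>M. 2 * real (L M) * ln (real M - real (L M)))"
  let ?D = "\<lambda>M. least_squares_decoder (N M) M (L M)"
  have LM: "L M \<le> M" for M
  proof -
    have "card (supp M (x M)) \<le> card {..<M}" by (intro card_mono) (auto simp: supp_def)
    then show ?thesis using L by (simp add: l0_def)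
  qed
  have L1: "eventually (\<lambda>M. 1 \<le> L M) sequentially"
    using Linf by (simp add: filterlim_at_top)
  have half: "eventually (\<lambda>M. 2 * L M \<le> M) sequentially"
    using landau_o.smallD[OF o, of "1/2"] by (auto elim!: eventually_mono)
  have ln1: "eventually (\<lambda>M. 1 \<le> ln (real M - real (L M))) sequentially"
    using half eventually_ge_at_top[of 6]
  proof eventually_elim
    case (elim M)
    have "exp 1 \<le> (3 :: real)" using exp_le by simp
    also have "3 \<le> real M - real (L M)" using elim by linarith
    finally have "exp 1 \<le> real M - real (L M)" .
    moreover from this have "0 < real M - real (L M)" using less_le_trans[OF exp_gt_zero] by blast
    ultimately show ?case by (simp only: ln_ge_iff)
  qed
  have Nge: "eventually (\<lambda>M. 2 * real (L M) * ln (real M - real (L M)) \<le> real (N M)) sequentially"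
  proof -
    have pos: "eventually (\<lambda>M. 0 < 2 * real (L M) * ln (real M - real (L M))) sequentially"
      using L1 ln1 by eventually_elim auto
    \<comment> \<open>If both sides of \<open>asymp_succ\<close> vanish identically the inequality
      is trivial; otherwise the quotient is cleared where its denominator is positive, which is the
      case for large \<open>M\<close>.\<close>
    from succ consider "\<forall>M. 2 * real (L M) * ln (real M - real (L M)) = 0"
      | M0 where "\<forall>M>M0. real (N M) / (2 * real (L M) * ln (real M - real (L M))) > 1"
      unfolding asymp_succ_def by blast
    then show ?thesis
    proof cases
      case 1
      then show ?thesis by (intro always_eventually allI) (simp only: of_nat_0_le_iff)
    next
      case 2
      show ?thesis using pos eventually_gt_at_top[of M0]
      proof eventually_elim
        case (elim M)
        then show ?case using 2 less_divide_eq_1_pos by (metis less_imp_le)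
      qed
    qed
  qed
  have \<mu>6: "eventually (\<lambda>M. 6 \<le> ln (1 + real (L M) * ((min_mag M (x M))\<^sup>2 / (4 * \<nu>\<^sup>2)))) sequentially"
  proof -
    \<comment> \<open>The threshold at which \<open>L * m^2 \<ge> c\<close>, with \<open>m\<close>
      the minimal magnitude, makes the logarithm at least 6. Squares are compared:
      \<open>(L * m^2)^2 = L * (L * m^4)\<close>, which is at least \<open>L * m^4\<close> once
      \<open>L \<ge> 1\<close>.\<close>
    define c where "c = 4 * \<nu>\<^sup>2 * exp 6"
    have "eventually (\<lambda>M. c\<^sup>2 \<le> real (L M) * min_mag M (x M) ^ 4) sequentially"
      using \<mu> by (simp add: filterlim_at_top)
    then show ?thesis using L1
    proof eventually_elim
      case (elim M)
      have "c\<^sup>2 \<le> 1 * (real (L M) * min_mag M (x M) ^ 4)" using elim by simp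
      also have "\<dots> \<le> real (L M) * (real (L M) * min_mag M (x M) ^ 4)"
        using elim by (intro mult_right_mono) auto
      also have "\<dots> = (real (L M) * (min_mag M (x M))\<^sup>2)\<^sup>2"
        by (simp add: power_mult_distrib power2_eq_square power4_eq_xxxx)
      finally have "c \<le> real (L M) * (min_mag M (x M))\<^sup>2"
        by (rule power2_le_imp_le) simp
      then have "exp 6 \<le> real (L M) * ((min_mag M (x M))\<^sup>2 / (4 * \<nu>\<^sup>2))"
        using \<nu> by (simp add: c_def field_simps)
      then have "exp 6 \<le> 1 + real (L M) * ((min_mag M (x M))\<^sup>2 / (4 * \<nu>\<^sup>2))" by simp
      moreover from this have "0 < 1 + real (L M) * ((min_mag M (x M))\<^sup>2 / (4 * \<nu>\<^sup>2))"
        using less_le_trans[OF exp_gt_zero] by blast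
      ultimately show ?case by (simp only: ln_ge_iff)
    qed
  qed
  have lim: "(\<lambda>M. exp (16 / (real M)\<^sup>2) - 1) \<longlonglongrightarrow> 0"
    by real_asymp
  show "reliable_recovery_possible \<nu> N x"
    unfolding reliable_recovery_possible_def
  proof (intro exI[of _ ?D] conjI allI impI)
    show "is_decoder N (\<lambda>M. l0 M (x M)) ?D"
      unfolding is_decoder_def
      using measurable_least_squares_decoder[OF LM] L by (simp add: candidates_def)
    fix x' assume x': "\<forall>M. l0 M (x' M) = l0 M (x M) \<and> min_mag M (x' M) = min_mag M (x M)"
    show "achieves_reliable_recovery \<nu> N ?D x'"
      unfolding achieves_reliable_recovery_def
    proof (rule tendsto_sandwich[OF _ _ tendsto_const lim])
      show "eventually (\<lambda>M. 0 \<le> p_err \<nu> (N M) M (?D M) (x' M)) sequentially"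
        by (simp add: p_err_def p_err_given_def)
      show "eventually (\<lambda>M. p_err \<nu> (N M) M (?D M) (x' M) \<le> exp (16 / (real M)\<^sup>2) - 1) sequentially"
        using L1 half ln1 Nge \<mu>6
      proof eventually_elim
        case (elim M)
        then show ?case
          using x' L \<nu> by (intro p_err_le_exp) (auto simp: l0_def)
      qed
    qed
  qed
qed simp

end
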